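(* Let $w\in\mathcal{W}_c$ be a fully commutative element and suppose $w=s_{i_1}\cdots s_{i_k}$ is a reduced expression. Then $$T(i_1\cdots i_k)=Q(i_1\cdots i_k).$$
   Context: **Weyl lines.** Let $n\ge 1$, $k$ a field of characteristic $0$, $\mathcal{W}=S_{n+1}$ (Coxeter group of type $A_n$) with simple reflections $s_i=(i,i+1)$, $1\le i\le n$; $T$ is the set of reflections (transpositions). $V$ is the $n$-dimensional geometric (reflection) representation of $\mathcal{W}$ over $k$ and $H_t\subset V$ the reflecting hyperplane of $t\in T$. A Weyl line is a one-dimensional subspace of $V$ that is an intersection of reflecting hyperplanes (for $n=1$, $V$ itself); it is transverse to $t\in T$ if it is not contained in $H_t$. $V_t$ is the union of the Weyl lines transverse to $t$; $V_i:=V_{s_i}$. For a nonempty sequence of indices in $\{1,\dots,n\}$ define inductively $W_i=V_i$ and $W_{i_1\cdots i_m}=V_{i_1}\cap(W_{i_2\cdots i_m}\cup s_{i_1}W_{i_2\cdots i_m})$. **$T(i_1\cdots i_k)$.** For $W=W_{i_1\cdots i_k}$ there is a unique nonempty set $T_W\subset T$ of pairwise commuting reflections with $W=\bigcap_{t\in T_W}V_t$; this set is denoted $T(i_1\cdots i_k)$. **Fully commutative elements.** $w\in\mathcal{W}$ is fully commutative if any reduced expression can be obtained from any other using only relations $st=ts$ with $s,t$ simple; $\mathcal{W}_c$ is the set of such elements. **Planar diagrams.** The Temperley-Lieb algebra $\mathrm{TL}_n$ over $\mathbb{Z}[\tau,\tau^{-1}]$ has generators $b_1,\dots,b_n$ and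 relations $b_jb_ib_j=b_j$ if $|i-j|=1$, $b_ib_j=b_jb_i$ if $|i-j|>1$, $b_i^2=(1+\tau^{-2})b_i$. It is realized by linear combinations of planar diagrams: two horizontal rows of $n+1$ points (numbered $1,\dots,n+1$ from left to right), joined in pairs by noncrossing arcs lying between the two rows, up to isotopy. The product $xy$ is obtained by placing the diagram of $x$ on top of that of $y$ and replacing each closed circle by a factor $1+\tau^{-2}$. The generator $b_i$ is the diagram with an arc joining points $i,i+1$ of the top row, an arc joining points $i,i+1$ of the bottom row, and vertical lines at all other points. For $w\in\mathcal{W}_c$ with reduced expression $s_{i_1}\cdots s_{i_k}$, $b_w=b_{i_1}\cdots b_{i_k}$ is a single diagram. **$Q(i_1\cdots i_k)$.** In the diagram of $b_w$ remove all lines joining a top point to a bottom point; $Q(i_1\cdots i_k)\subset T$ is the set of transpositions $(a,b)$ such that points $a$ and $b$ of the top row are joined by an arc. *)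

theory Defs
  imports
    Complex_Main
    "HOL-Combinatorics.Transposition"
    "HOL-Combinatorics.Permutations"
    "HOL-Library.Disjoint_Sets"
    "HOL-Library.Function_Algebras"
    "HOL-Library.Poly_Mapping"
begin

section \<open>The symmetric group as a Coxeter group\<close>

text \<open>The group $S_{n+1}$ consists of the functions \<open>w\<close> with \<open>w permutes {1..n+1}\<close>.\<close>

definition simple_refl :: "nat \<Rightarrow> nat \<Rightarrow> nat" where
  "simple_refl i = transpose i (i + 1)"

definition reflections :: "nat \<Rightarrow> (nat \<Rightarrow> nat) set" where
  "reflections n = {transpose a b | a b. a \<in> {1..n+1} \<and> b \<in> {1..n+1} \<and> a \<noteq> b}"

definition word_prod :: "nat list \<Rightarrow> nat \<Rightarrow> nat" where
  "word_prod ws = foldr (\<lambda>i u. simple_refl i \<circ> u) ws id"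

definition expression :: "nat \<Rightarrow> nat list \<Rightarrow> (nat \<Rightarrow> nat) \<Rightarrow> bool" where
  "expression n ws w \<longleftrightarrow> set ws \<subseteq> {1..n} \<and> word_prod ws = w"

definition reduced_expression :: "nat \<Rightarrow> nat list \<Rightarrow> (nat \<Rightarrow> nat) \<Rightarrow> bool" where
  "reduced_expression n ws w \<longleftrightarrow>
     expression n ws w \<and> (\<forall>vs. expression n vs w \<longrightarrow> length ws \<le> length vs)"

definition commutation_move :: "nat list \<Rightarrow> nat list \<Rightarrow> bool" where
  "commutation_move us vs \<longleftrightarrow>
     (\<exists>xs i j ys. us = xs @ [i, j] @ ys \<and> vs = xs @ [j, i] @ ys \<and>
        simple_refl i \<circ> simple_refl j = simple_refl j \<circ> simple_refl i)"

definition fully_commutative :: "nat \<Rightarrow> (nat \<Rightarrow> nat) \<Rightarrow> bool" where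
  "fully_commutative n w \<longleftrightarrow>
     w permutes {1..n+1} \<and>
     (\<forall>us vs. reduced_expression n us w \<longrightarrow> reduced_expression n vs w \<longrightarrow>
        commutation_move\<^sup>*\<^sup>* us vs)"


section \<open>Weyl lines\<close>

text \<open>
  Vectors are functions \<open>nat \<Rightarrow> 'k\<close>. The geometric representation is realised as the space of
  vectors supported on \<open>{1..n+1}\<close> with coordinate sum zero, on which $S_{n+1}$ permutes the
  coordinates; the simple roots are $\alpha_i = e_i - e_{i+1}$ for $1 \le i \le n$.
\<close>

definition fscale :: "'k::field \<Rightarrow> (nat \<Rightarrow> 'k) \<Rightarrow> nat \<Rightarrow> 'k" where
  "fscale c v = (\<lambda>i. c * v i)"

global_interpretation fvec: vector_space "fscale :: 'k::field \<Rightarrow> (nat \<Rightarrow> 'k) \<Rightarrow> nat \<Rightarrow> 'k"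
  by unfold_locales (auto simp: fscale_def fun_eq_iff algebra_simps)

definition geom_rep :: "nat \<Rightarrow> (nat \<Rightarrow> 'k::field) set" where
  "geom_rep n = {v. (\<forall>i. i \<notin> {1..n+1} \<longrightarrow> v i = 0) \<and> (\<Sum>i\<in>{1..n+1}. v i) = 0}"

definition act :: "(nat \<Rightarrow> nat) \<Rightarrow> (nat \<Rightarrow> 'k) \<Rightarrow> nat \<Rightarrow> 'k" where
  "act w v = (\<lambda>i. v (inv w i))"

definition simple_root :: "nat \<Rightarrow> nat \<Rightarrow> 'k::field" where
  "simple_root i = (\<lambda>j. if j = i then 1 else if j = i + 1 then -1 else 0)"

text \<open>The type $A_n$ reflection formula $s_i(\alpha_j) = \alpha_j - a_{ij} \alpha_i$.\<close>

lemma act_simple_root: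
  "act (simple_refl i) (simple_root j :: nat \<Rightarrow> 'k::field) =
     simple_root j -
     fscale (if i = j then 2 else if i = j + 1 \<or> j = i + 1 then -1 else 0) (simple_root i)"
  by (auto simp: act_def simple_refl_def simple_root_def fscale_def fun_eq_iff transpose_def)

definition hyperplane :: "nat \<Rightarrow> (nat \<Rightarrow> nat) \<Rightarrow> (nat \<Rightarrow> 'k::field) set" where
  "hyperplane n t = {v \<in> geom_rep n. act t v = v}"

text \<open>
  The empty set of reflections is allowed, with \<open>geom_rep n\<close> as its intersection; by the
  dimension condition it contributes a line only for $n = 1$.
\<close>

definition weyl_line :: "nat \<Rightarrow> (nat \<Rightarrow> 'k::field) set \<Rightarrow> bool" where
  "weyl_line n L \<longleftrightarrow>
     fvec.subspace L \<and> fvec.dim L = 1 \<and>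
     (\<exists>S. S \<subseteq> reflections n \<and> L = geom_rep n \<inter> (\<Inter>t\<in>S. hyperplane n t))"

definition transverse :: "nat \<Rightarrow> (nat \<Rightarrow> 'k::field) set \<Rightarrow> (nat \<Rightarrow> nat) \<Rightarrow> bool" where
  "transverse n L t \<longleftrightarrow> \<not> L \<subseteq> hyperplane n t"

definition V_refl :: "nat \<Rightarrow> (nat \<Rightarrow> nat) \<Rightarrow> (nat \<Rightarrow> 'k::field) set" where
  "V_refl n t = \<Union>{L. weyl_line n L \<and> transverse n L t}"

text \<open>Only nonempty words matter; the value at the empty word is left unspecified.\<close>

fun W_word :: "nat \<Rightarrow> nat list \<Rightarrow> (nat \<Rightarrow> 'k::field) set" where
  "W_word n [i] = V_refl n (simple_refl i)"
| "W_word n (i # j # js) =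
     V_refl n (simple_refl i) \<inter>
     (W_word n (j # js) \<union> act (simple_refl i) ` W_word n (j # js))"

text \<open>The field \<open>'k\<close> does not occur in the result type, hence the explicit type argument.\<close>

definition T_word :: "'k::field itself \<Rightarrow> nat \<Rightarrow> nat list \<Rightarrow> (nat \<Rightarrow> nat) set" where
  "T_word _ n ws =
     (THE S. S \<noteq> {} \<and> S \<subseteq> reflections n \<and> (\<forall>s\<in>S. \<forall>t\<in>S. s \<circ> t = t \<circ> s) \<and>
        (W_word n ws :: (nat \<Rightarrow> 'k) set) = (\<Inter>t\<in>S. V_refl n t))"


section \<open>The Temperley-Lieb algebra of planar diagrams\<close>

datatype point = Top nat | Bot nat

type_synonym diagram = "point set set"

definition points :: "nat \<Rightarrow> point set" where
  "points n = Top ` {1..n+1} \<union> Bot ` {1..n+1}"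

text \<open>Position of a point when walking clockwise around the boundary of the strip.\<close>

fun boundary_pos :: "nat \<Rightarrow> point \<Rightarrow> nat" where
  "boundary_pos n (Top i) = i"
| "boundary_pos n (Bot i) = 2 * n + 3 - i"

definition planar_diagram :: "nat \<Rightarrow> diagram \<Rightarrow> bool" where
  "planar_diagram n d \<longleftrightarrow>
     partition_on (points n) d \<and> (\<forall>arc\<in>d. card arc = 2) \<and>
     \<not> (\<exists>p q r s. {p, q} \<in> d \<and> {r, s} \<in> d \<and>
          boundary_pos n p < boundary_pos n r \<and> boundary_pos n r < boundary_pos n q \<and>
          boundary_pos n q < boundary_pos n s)"

text \<open>
  To multiply, \<open>d\<close> is placed on top of \<open>e\<close>, the bottom row of \<open>d\<close> being identified with the top
  row of \<open>e\<close> (the middle row). If an arc of \<open>d\<close> and an arc of \<open>e\<close> have the same two end points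
  in the middle row, they are merged into one element of \<open>stack d e\<close>; this does not affect
  connected components. The closed circles are the components lying in the middle row.
\<close>

datatype stack_point = Upper nat | Middle nat | Lower nat

fun upper_half :: "point \<Rightarrow> stack_point" where
  "upper_half (Top i) = Upper i"
| "upper_half (Bot i) = Middle i"

fun lower_half :: "point \<Rightarrow> stack_point" where
  "lower_half (Top i) = Middle i"
| "lower_half (Bot i) = Lower i"

fun outer :: "point \<Rightarrow> stack_point" where
  "outer (Top i) = Upper i"
| "outer (Bot i) = Lower i"

definition stack :: "diagram \<Rightarrow> diagram \<Rightarrow> stack_point set set" where
  "stack d e = (`) upper_half ` d \<union> (`) lower_half ` e"

definition connected_in_stack :: "diagram \<Rightarrow> diagram \<Rightarrow> stack_point \<Rightarrow> stack_point \<Rightarrow> bool" where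
  "connected_in_stack d e = (\<lambda>x y. {x, y} \<in> stack d e)\<^sup>*\<^sup>*"

definition diagram_comp :: "diagram \<Rightarrow> diagram \<Rightarrow> diagram" where
  "diagram_comp d e = {{p, q} | p q. p \<noteq> q \<and> connected_in_stack d e (outer p) (outer q)}"

definition circles :: "nat \<Rightarrow> diagram \<Rightarrow> diagram \<Rightarrow> nat" where
  "circles n d e =
     card {C. (\<exists>i\<in>{1..n+1}. C = {x. connected_in_stack d e (Middle i) x}) \<and> C \<subseteq> range Middle}"

text \<open>
  The type \<open>int \<Rightarrow>\<^sub>0 int\<close> with convolution is the Laurent polynomial ring $\mathbb{Z}[\tau,\tau^{-1}]$,
  the monomial $c \tau^m$ being \<open>single m c\<close>.
\<close>

type_synonym laurent = "int \<Rightarrow>\<^sub>0 int"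

definition circle_factor :: laurent where
  "circle_factor = 1 + Poly_Mapping.single (- 2) 1"

text \<open>
  Elements of $\mathrm{TL}_n$ are finitely supported functions from diagrams to Laurent
  polynomials. The bilinear product is written down for all such functions; those supported on
  planar diagrams are closed under it.
\<close>

definition tl_mult :: "nat \<Rightarrow> (diagram \<Rightarrow>\<^sub>0 laurent) \<Rightarrow> (diagram \<Rightarrow>\<^sub>0 laurent) \<Rightarrow> (diagram \<Rightarrow>\<^sub>0 laurent)"
  where
  "tl_mult n x y =
     (\<Sum>d\<in>Poly_Mapping.keys x. \<Sum>e\<in>Poly_Mapping.keys y.
        Poly_Mapping.single (diagram_comp d e)
          (Poly_Mapping.lookup x d * Poly_Mapping.lookup y e * circle_factor ^ circles n d e))"

definition tl_one :: "nat \<Rightarrow> (diagram \<Rightarrow>\<^sub>0 laurent)" where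
  "tl_one n = Poly_Mapping.single {{Top j, Bot j} | j. j \<in> {1..n+1}} 1"

definition tl_gen :: "nat \<Rightarrow> nat \<Rightarrow> (diagram \<Rightarrow>\<^sub>0 laurent)" where
  "tl_gen n i =
     Poly_Mapping.single
       ({{Top i, Top (i + 1)}, {Bot i, Bot (i + 1)}} \<union>
        {{Top j, Bot j} | j. j \<in> {1..n+1} \<and> j \<noteq> i \<and> j \<noteq> i + 1}) 1"

definition b_word :: "nat \<Rightarrow> nat list \<Rightarrow> (diagram \<Rightarrow>\<^sub>0 laurent)" where
  "b_word n ws = foldr (\<lambda>i x. tl_mult n (tl_gen n i) x) ws (tl_one n)"

text \<open>The diagram of an element of $\mathrm{TL}_n$ that is a nonzero multiple of a single diagram.\<close>

definition diagram_of :: "nat \<Rightarrow> (diagram \<Rightarrow>\<^sub>0 laurent) \<Rightarrow> diagram" where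
  "diagram_of n x = (THE d. planar_diagram n d \<and> Poly_Mapping.keys x = {d})"

definition Q_word :: "nat \<Rightarrow> nat list \<Rightarrow> (nat \<Rightarrow> nat) set" where
  "Q_word n ws = {transpose a b | a b. {Top a, Top b} \<in> diagram_of n (b_word n ws)}"

end

theory Submission
  imports Defs
begin

text \<open>
  A Weyl line consists of the vectors that are constant on each of the two parts of a cut of
  \<open>{1..n+1}\<close>, and it is transverse to the reflection \<open>(a b)\<close> iff the cut separates \<open>a\<close> and \<open>b\<close>.
  So, apart from the zero vector, \<open>V_refl n (transpose a b)\<close> is the set of sum-zero vectors \<open>v\<close> that
  take two values and have \<open>v a \<noteq> v b\<close> (\<open>V_refl_transpose\<close>). Such a vector is read as a
  colouring of the points of the top row with two colours.

  On the other side, a planar diagram is a perfect matching of the points. Multiplying \<open>d\<close> by the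
  generator \<open>b\<^sub>i\<close> from above leaves \<open>d\<close> unchanged, up to a circle, if \<open>d\<close> joins \<open>i\<close> and \<open>i + 1\<close> in
  the top row; otherwise it joins these two points and also their former partners
  (\<open>gen_comp_cases\<close>). Consequently every \<open>b_word\<close> is a nonzero multiple of one planar diagram.

  Call a two-valued vector a proper colouring of \<open>d\<close> if it gives different colours to the two ends
  of each arc within the top row. There are only two colours, so when \<open>v i \<noteq> v (i + 1)\<close> the vector
  \<open>v\<close> is a proper colouring of \<open>b\<^sub>i d\<close> iff \<open>v\<close> or \<open>s\<^sub>i v\<close>, which differs by exchanging the colours of
  \<open>i\<close> and \<open>i + 1\<close>, is one of \<open>d\<close> (\<open>proper_colorings_gen_comp\<close>). This is the recursion that
  defines \<open>W_word\<close>; hence \<open>W_word n ws\<close> consists of zero and the proper colourings of the diagram of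
  \<open>ws\<close> (\<open>W_word_eq\<close>), which is the intersection of the sets \<open>V_refl n t\<close> with \<open>t\<close> in
  \<open>Q_word n ws\<close>.

  The arcs of a matching are disjoint, so \<open>Q_word n ws\<close> is a set of commuting reflections, and a
  nonempty set \<open>S\<close> of commuting reflections can be recovered from that intersection: a reflection
  \<open>(a b)\<close> outside \<open>S\<close> is not transverse to some Weyl line that is transverse to all of \<open>S\<close>
  (\<open>mem_commuting_iff\<close>).
\<close>


section \<open>Weyl lines as cuts of the index set\<close>

text \<open>
  At most two values are allowed so that zero belongs to the set; as the characteristic is 0 and
  the coordinates sum to zero, it is the only constant vector there.
\<close>

definition two_valued :: "nat \<Rightarrow> (nat \<Rightarrow> 'k::field) set" where
  "two_valued n = {v \<in> geom_rep n. card (v ` {1..n+1}) \<le> 2}"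

lemma act_transpose_apply:
  "act (transpose a b) v = (\<lambda>x. v (transpose a b x))"
  by (simp add: act_def inv_equality)

lemma act_transpose_involutory: "act (transpose a b) (act (transpose a b) v) = v"
  by (simp add: act_transpose_apply)

lemma act_transpose_fixed_iff: "act (transpose a b) v = v \<longleftrightarrow> v a = v b"
  unfolding act_transpose_apply fun_eq_iff
  by (metis transpose_apply_first transpose_apply_other transpose_apply_second)

lemma hyperplane_transpose: "hyperplane n (transpose a b) = {v \<in> geom_rep n. v a = v b}"
  by (simp add: hyperplane_def act_transpose_fixed_iff)

lemma reflectionsE:
  assumes "t \<in> reflections n"
  obtains a b where "t = transpose a b" "a \<in> {1..n+1}" "b \<in> {1..n+1}" "a \<noteq> b"
  using assms unfolding reflections_def by blast

lemma two_valued_pigeonhole: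
  assumes "v \<in> two_valued n" "x \<in> {1..n+1}" "y \<in> {1..n+1}" "z \<in> {1..n+1}" "v x \<noteq> v y"
  shows "v z = v x \<or> v z = v y"
proof (rule ccontr)
  assume "\<not> ?thesis"
  then have "card {v x, v y, v z} = 3" using assms(5) by auto
  moreover have "{v x, v y, v z} \<subseteq> v ` {1..n+1}" using assms(2-4) by blast
  then have "card {v x, v y, v z} \<le> card (v ` {1..n+1})" by (intro card_mono) auto
  ultimately show False using assms(1) by (simp add: two_valued_def)
qed

lemma sum_over_two_levels:
  fixes n :: nat and u :: "nat \<Rightarrow> 'k::field"
  assumes "A \<subseteq> {1..n+1}" "\<And>x. x \<in> A \<Longrightarrow> u x = \<alpha>" "\<And>x. x \<in> {1..n+1} - A \<Longrightarrow> u x = \<beta>"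
  shows "(\<Sum>x\<in>{1..n+1}. u x) = of_nat (card A) * \<alpha> + of_nat (card ({1..n+1} - A)) * \<beta>"
proof -
  have "(\<Sum>x\<in>{1..n+1}. u x) = (\<Sum>x\<in>A. u x) + (\<Sum>x\<in>{1..n+1} - A. u x)"
    using assms(1) by (subst sum.subset_diff[of A]) (auto simp: add.commute)
  also have "(\<Sum>x\<in>A. u x) = (\<Sum>x\<in>A. \<alpha>)" using assms(2) by (intro sum.cong) auto
  also have "(\<Sum>x\<in>{1..n+1} - A. u x) = (\<Sum>x\<in>{1..n+1} - A. \<beta>)"
    using assms(3) by (intro sum.cong) auto
  finally show ?thesis by simp
qed

text \<open>
  The value on each part is, up to sign, the size of the other part, so that the coordinates sum to
  zero.
\<close>

definition cut_vector :: "nat \<Rightarrow> nat set \<Rightarrow> nat \<Rightarrow> 'k::field" where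
  "cut_vector n A x =
     (if x \<notin> {1..n+1} then 0
      else if x \<in> A then of_nat (card ({1..n+1} - A)) else - of_nat (card A))"

lemma cut_vector_two_valued:
  assumes "A \<subseteq> {1..n+1}"
  shows "(cut_vector n A :: nat \<Rightarrow> 'k::field) \<in> two_valued n"
proof -
  have "(\<Sum>x\<in>{1..n+1}. cut_vector n A x :: 'k) =
      of_nat (card A) * of_nat (card ({1..n+1} - A)) +
      of_nat (card ({1..n+1} - A)) * (- of_nat (card A))"
    by (rule sum_over_two_levels) (use assms in \<open>auto simp: cut_vector_def\<close>)
  then have "(cut_vector n A :: nat \<Rightarrow> 'k) \<in> geom_rep n"
    by (simp add: geom_rep_def cut_vector_def)
  moreover have "card ((cut_vector n A :: nat \<Rightarrow> 'k) ` {1..n+1}) \<le>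
      card {of_nat (card ({1..n+1} - A)), - of_nat (card A) :: 'k}"
    by (rule card_mono) (auto simp: cut_vector_def)
  then have "card ((cut_vector n A :: nat \<Rightarrow> 'k) ` {1..n+1}) \<le> 2"
    by (rule order_trans) (simp add: card_insert_if)
  ultimately show ?thesis by (simp add: two_valued_def)
qed

text \<open>
  The two values differ by \<open>n + 1\<close>, which is nonzero in characteristic 0.
\<close>

lemma cut_vector_eq_iff:
  assumes "A \<subseteq> {1..n+1}" "x \<in> {1..n+1}" "y \<in> {1..n+1}"
  shows "(cut_vector n A x :: 'k::field_char_0) = cut_vector n A y \<longleftrightarrow> (x \<in> A \<longleftrightarrow> y \<in> A)"
proof -
  have ne: "(of_nat (card ({1..n+1} - A)) :: 'k) \<noteq> - of_nat (card A)" if "z \<in> A" for z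
  proof
    assume "(of_nat (card ({1..n+1} - A)) :: 'k) = - of_nat (card A)"
    then have "(of_nat (card ({1..n+1} - A) + card A) :: 'k) = 0" by simp
    then have "card A = 0" unfolding of_nat_eq_0_iff by simp
    then show False using that assms(1) finite_subset[OF assms(1)] by auto
  qed
  show ?thesis using assms ne[of x] ne[of y] by (auto simp: cut_vector_def)
qed

lemma weyl_line_proportional:
  assumes "weyl_line n L" "v \<in> L" "x \<in> L" "v \<noteq> 0"
  obtains c where "x = fscale c v"
proof -
  obtain B where B: "L \<subseteq> fvec.span B" "card B = fvec.dim L"
    by (rule fvec.basis_exists[of L])
  then obtain u where u: "B = {u}"
    using assms(1) by (auto simp: weyl_line_def card_1_singleton_iff)
  have "v \<in> range (\<lambda>c. fscale c u)" "x \<in> range (\<lambda>c. fscale c u)"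
    using B(1) assms(2,3) unfolding u fvec.span_singleton by auto
  then obtain c d where cd: "v = fscale c u" "x = fscale d u" by blast
  have "c \<noteq> 0" using assms(4) cd(1) by (auto simp: fscale_def fun_eq_iff)
  then have "x = fscale (d / c) v" by (simp add: cd fscale_def fun_eq_iff)
  then show ?thesis by (rule that)
qed

text \<open>
  Suppose that \<open>v\<close> takes three different values. A vector that takes the value \<open>card B\<close> on one level
  set \<open>A\<close> of \<open>v\<close>, the value \<open>- card A\<close> on another one \<open>B\<close> and is zero elsewhere satisfies the
  equations that cut out the line, hence is a nonzero multiple of \<open>v\<close>. So \<open>v\<close> vanishes outside
  \<open>A \<union> B\<close>. Two choices of the pair \<open>A\<close>, \<open>B\<close> then show that two of the three values are zero,
  although they differ.
\<close>

lemma weyl_line_two_valued: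
  fixes v :: "nat \<Rightarrow> 'k::field_char_0"
  assumes "weyl_line n L" "v \<in> L"
  shows "v \<in> two_valued n"
proof (cases "v = 0")
  case True
  have "card ((\<lambda>x. 0::'k) ` {1..n+1}) \<le> 1"
    by (rule order_trans[OF card_mono[of "{0}"]]) auto
  then show ?thesis unfolding True zero_fun_def two_valued_def by (simp add: geom_rep_def)
next
  case False
  obtain S where S: "S \<subseteq> reflections n" "L = geom_rep n \<inter> (\<Inter>t\<in>S. hyperplane n t)"
    using assms(1) by (auto simp: weyl_line_def)
  have v: "v \<in> geom_rep n" using assms(2) S by auto
  have scalar: "\<exists>c. x = fscale c v" if "x \<in> L" for x
    using weyl_line_proportional[OF assms that False] by blast
  have third_zero: "v z = 0"
    if xyz: "x \<in> {1..n+1}" "y \<in> {1..n+1}" "z \<in> {1..n+1}"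
       "v x \<noteq> v y" "v z \<noteq> v x" "v z \<noteq> v y" for x y z
  proof -
    \<comment> \<open>Let \<open>f\<close> be the vector described above, for \<open>A = {v = v x}\<close> and \<open>B = {v = v y}\<close>.\<close>
    define m where "m w = card {j \<in> {1..n+1}. v j = v w}" for w
    define f :: "nat \<Rightarrow> 'k" where
      "f j = (if j \<notin> {1..n+1} then 0 else (if v j = v x then of_nat (m y) else 0)
          - (if v j = v y then of_nat (m x) else 0))" for j
    have cnt: "(\<Sum>j\<in>{1..n+1}. if v j = v w then c else 0) = of_nat (m w) * (c::'k)" for w c
      unfolding m_def by (subst sum.inter_filter[symmetric]) simp_all
    have "(\<Sum>j\<in>{1..n+1}. f j) = (\<Sum>j\<in>{1..n+1}. (if v j = v x then of_nat (m y) else 0)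
          - (if v j = v y then of_nat (m x) else 0))"
      by (rule sum.cong) (auto simp: f_def)
    also have "\<dots> = 0" unfolding sum_subtractf cnt by simp
    finally have "f \<in> geom_rep n" by (simp add: geom_rep_def f_def)
    moreover have "f \<in> hyperplane n t" if "t \<in> S" for t
    proof -
      obtain a b where t: "t = transpose a b" "a \<in> {1..n+1}" "b \<in> {1..n+1}"
        using reflectionsE[of t n] S(1) \<open>t \<in> S\<close> by blast
      have "v a = v b" using assms(2) S(2) \<open>t \<in> S\<close> by (auto simp: t hyperplane_transpose)
      then show ?thesis using \<open>f \<in> geom_rep n\<close> t(2,3) by (auto simp: t(1) hyperplane_transpose f_def)
    qed
    ultimately obtain c where c: "f = fscale c v" using scalar S(2) by blast
    have "y \<in> {j \<in> {1..n+1}. v j = v y}" using xyz by simp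
    then have "m y \<noteq> 0" unfolding m_def by (subst card_0_eq) auto
    then have "f x \<noteq> 0" using xyz by (simp add: f_def)
    then have "c \<noteq> 0" by (auto simp: c fscale_def)
    moreover have "f z = 0" using xyz by (simp add: f_def)
    ultimately show ?thesis by (simp add: c fscale_def)
  qed
  have "card (v ` {1..n+1}) \<le> 2"
  proof (rule ccontr)
    assume "\<not> ?thesis"
    then obtain C where "C \<subseteq> v ` {1..n+1}" "card C = 3"
      by (metis not_less_eq_eq numeral_3_eq_3 numeral_2_eq_2 obtain_subset_with_card_n)
    then obtain \<alpha> \<beta> \<gamma> where "C = {\<alpha>, \<beta>, \<gamma>}" "\<alpha> \<noteq> \<beta>" "\<alpha> \<noteq> \<gamma>" "\<beta> \<noteq> \<gamma>"
      by (auto simp: card_3_iff)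
    with \<open>C \<subseteq> _\<close> obtain x y z where
      "x \<in> {1..n+1}" "y \<in> {1..n+1}" "z \<in> {1..n+1}" "v x \<noteq> v y" "v z \<noteq> v x" "v z \<noteq> v y"
      by auto
    then show False using third_zero[of x y z] third_zero[of z y x] by metis
  qed
  then show ?thesis using v by (simp add: two_valued_def)
qed

text \<open>
  The reflections that fix \<open>v\<close> cut out the sum-zero vectors that are constant on the two level sets
  of \<open>v\<close>. The sum being zero determines the value on one level set from that on the other, so these
  vectors form a line.
\<close>

lemma weyl_line_through_two_valued:
  fixes v :: "nat \<Rightarrow> 'k::field_char_0"
  assumes v: "v \<in> two_valued n" and ab: "a \<in> {1..n+1}" "b \<in> {1..n+1}" "v a \<noteq> v b"
  shows "weyl_line n (fvec.span {v})"
proof -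
  define S where
    "S = {transpose c d | c d. c \<in> {1..n+1} \<and> d \<in> {1..n+1} \<and> c \<noteq> d \<and> v c = v d}"
  have "v \<noteq> 0" using ab(3) by auto
  define A where "A = {x \<in> {1..n+1}. v x = v a}"
  have A: "A \<subseteq> {1..n+1}" "a \<in> A" "b \<in> {1..n+1} - A" using ab by (auto simp: A_def)
  have vg: "v \<in> geom_rep n" using v by (simp add: two_valued_def)
  have card0: "card A \<noteq> 0" "card ({1..n+1} - A) \<noteq> 0"
    using A finite_subset[OF A(1)] by auto
  have level: "of_nat (card A) * u a + of_nat (card ({1..n+1} - A)) * u b = 0"
    if that': "u \<in> geom_rep n"
      "\<And>c d. c \<in> {1..n+1} \<Longrightarrow> d \<in> {1..n+1} \<Longrightarrow> v c = v d \<Longrightarrow> u c = u d" for u :: "nat \<Rightarrow> 'k"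
  proof -
    have "u x = u b" if x: "x \<in> {1..n+1} - A" for x
    proof (rule that'(2))
      show "v x = v b"
        using two_valued_pigeonhole[OF v ab(1,2) _ ab(3), of x] x by (auto simp: A_def)
    qed (use x ab in auto)
    moreover have "u x = u a" if "x \<in> A" for x
      by (rule that'(2)) (use \<open>x \<in> A\<close> ab in \<open>auto simp: A_def\<close>)
    ultimately have "(\<Sum>x\<in>{1..n+1}. u x) =
        of_nat (card A) * u a + of_nat (card ({1..n+1} - A)) * u b"
      using A(1) by (intro sum_over_two_levels) auto
    then show ?thesis using that'(1) by (simp add: geom_rep_def)
  qed
  have lv: "of_nat (card A) * v a + of_nat (card ({1..n+1} - A)) * v b = 0"
    by (rule level[OF vg]) auto
  \<comment> \<open>If \<open>v a\<close> were zero, so would be \<open>v b\<close>, but these two differ.\<close>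
  have va: "v a \<noteq> 0" using lv card0 ab(3) by (metis add_0 mult_eq_0_iff mult_zero_right of_nat_eq_0_iff)
  have "fvec.span {v} = geom_rep n \<inter> (\<Inter>t\<in>S. hyperplane n t)"
  proof (intro equalityI subsetI)
    fix u :: "nat \<Rightarrow> 'k" assume "u \<in> fvec.span {v}"
    then obtain c where c: "u = fscale c v" by (auto simp: fvec.span_singleton)
    have "(\<Sum>x\<in>{1..n+1}. u x) = c * (\<Sum>x\<in>{1..n+1}. v x)"
      unfolding c fscale_def by (rule sum_distrib_left[symmetric])
    then have "u \<in> geom_rep n" using vg by (auto simp: c geom_rep_def fscale_def)
    then show "u \<in> geom_rep n \<inter> (\<Inter>t\<in>S. hyperplane n t)"
      by (auto simp: S_def hyperplane_transpose c fscale_def)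
  next
    fix u :: "nat \<Rightarrow> 'k" assume u: "u \<in> geom_rep n \<inter> (\<Inter>t\<in>S. hyperplane n t)"
    have const: "u c = u d" if "c \<in> {1..n+1}" "d \<in> {1..n+1}" "v c = v d" for c d
    proof (cases "c = d")
      case False
      then have "transpose c d \<in> S" using that unfolding S_def by blast
      then show ?thesis using u by (auto simp: hyperplane_transpose)
    qed simp
    have lu: "of_nat (card A) * u a + of_nat (card ({1..n+1} - A)) * u b = 0"
    proof (rule level[of u])
      show "u \<in> geom_rep n" using u by blast
    qed (rule const)
    define c where "c = u a / v a"
    have ua: "u a = c * v a" using va by (simp add: c_def)
    have "of_nat (card ({1..n+1} - A)) * (u b - c * v b) =
      (of_nat (card A) * u a + of_nat (card ({1..n+1} - A)) * u b)
      - c * (of_nat (card A) * v a + of_nat (card ({1..n+1} - A)) * v b)"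
      unfolding ua by (simp add: algebra_simps)
    then have "of_nat (card ({1..n+1} - A)) * (u b - c * v b) = 0" unfolding lu lv by simp
    then have ub: "u b = c * v b" using card0(2) by (metis eq_iff_diff_eq_0 mult_eq_0_iff of_nat_eq_0_iff)
    have "u x = c * v x" for x
    proof (cases "x \<in> {1..n+1}")
      case True
      then show ?thesis
        using two_valued_pigeonhole[OF v ab(1,2) True ab(3)] const[OF True ab(1)] const[OF True ab(2)] ua ub
        by metis
    next
      case False
      then show ?thesis using u vg by (auto simp: geom_rep_def)
    qed
    then have "u = fscale c v" by (simp add: fscale_def fun_eq_iff)
    then show "u \<in> fvec.span {v}" by (auto simp: fvec.span_singleton)
  qed
  moreover have "S \<subseteq> reflections n" by (auto simp: S_def reflections_def)
  moreover have "fvec.dim (fvec.span {v}) = 1"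
    using fvec.dim_span_eq_card_independent[of "{v}"] \<open>v \<noteq> 0\<close> by simp
  ultimately show ?thesis unfolding weyl_line_def using fvec.subspace_span by blast
qed

lemma V_refl_transpose:
  assumes ab: "a \<in> {1..n+1}" "b \<in> {1..n+1}" "a \<noteq> b"
  shows "V_refl n (transpose a b) =
    insert 0 {v :: nat \<Rightarrow> 'k::field_char_0. v \<in> two_valued n \<and> v a \<noteq> v b}"
proof (intro equalityI subsetI)
  fix v :: "nat \<Rightarrow> 'k" assume "v \<in> V_refl n (transpose a b)"
  then obtain L where L: "weyl_line n L" "transverse n L (transpose a b)" "v \<in> L"
    by (auto simp: V_refl_def)
  show "v \<in> insert 0 {v. v \<in> two_valued n \<and> v a \<noteq> v b}"
  proof (cases "v = 0")
    case False
    obtain u where u: "u \<in> L" "u a \<noteq> u b"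
    proof -
      have "L \<subseteq> geom_rep n" using L(1) by (auto simp: weyl_line_def)
      then show ?thesis using L(2) that by (auto simp: transverse_def hyperplane_transpose)
    qed
    obtain c where "u = fscale c v" using weyl_line_proportional[OF L(1,3) u(1) False] .
    then have "v a \<noteq> v b" using u(2) by (auto simp: fscale_def)
    then show ?thesis using weyl_line_two_valued[OF L(1,3)] by simp
  qed simp
next
  have line: "v \<in> V_refl n (transpose a b) \<and> (0 :: nat \<Rightarrow> 'k) \<in> V_refl n (transpose a b)"
    if "v \<in> two_valued n" "v a \<noteq> v b" for v :: "nat \<Rightarrow> 'k"
  proof -
    have "v \<in> fvec.span {v}" by (simp add: fvec.span_base)
    moreover have "transverse n (fvec.span {v}) (transpose a b)"
      using calculation that(2) by (auto simp: transverse_def hyperplane_transpose)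
    ultimately have "fvec.span {v} \<subseteq> V_refl n (transpose a b)"
      using weyl_line_through_two_valued[OF that(1) ab(1,2) that(2)]
      unfolding V_refl_def by (intro Union_upper) simp
    then show ?thesis
      using subsetD[OF _ \<open>v \<in> fvec.span {v}\<close>] subsetD[OF _ fvec.span_zero[of "{v}"]] by simp
  qed
  \<comment> \<open>Zero lies on every line, so it suffices that some Weyl line is transverse to \<open>(a b)\<close>.\<close>
  have "(cut_vector n {a} :: nat \<Rightarrow> 'k) \<in> two_valued n"
    by (rule cut_vector_two_valued) (use ab in auto)
  moreover have "(cut_vector n {a} a :: 'k) \<noteq> cut_vector n {a} b"
    by (subst cut_vector_eq_iff) (use ab in auto)
  ultimately have zero: "0 \<in> (V_refl n (transpose a b) :: (nat \<Rightarrow> 'k) set)"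
    by (rule conjunct2[OF line])
  fix v :: "nat \<Rightarrow> 'k" assume "v \<in> insert 0 {v. v \<in> two_valued n \<and> v a \<noteq> v b}"
  then consider "v = 0" | "v \<in> two_valued n" "v a \<noteq> v b" by blast
  then show "v \<in> V_refl n (transpose a b)"
  proof cases
    case 1
    then show ?thesis using zero by simp
  next
    case 2
    then show ?thesis by (rule conjunct1[OF line])
  qed
qed


section \<open>Recovering a set of commuting reflections\<close>

lemma commuting_transpositions_disjoint:
  assumes "transpose a b \<circ> transpose a c = transpose a c \<circ> transpose a b" "a \<noteq> b" "a \<noteq> c"
  shows "b = c"
  using fun_cong[OF assms(1), of a] fun_cong[OF assms(1), of b] assms(2,3)
  by (auto simp: transpose_def split: if_splits)

text \<open>
  Commuting transpositions have disjoint supports, so the elements of \<open>S\<close> form a matching, which is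
  two-coloured arc by arc. Of an arc that avoids \<open>a\<close> and \<open>b\<close> the smaller end is put into \<open>A\<close>; of any
  other arc it is the end in \<open>{a, b}\<close>, of which there is just one as \<open>(a b)\<close> is not in \<open>S\<close>.
\<close>

lemma separating_coloring:
  assumes S: "S \<subseteq> reflections n" "\<forall>s\<in>S. \<forall>t\<in>S. s \<circ> t = t \<circ> s"
    and ab: "a \<in> {1..n+1}" "b \<in> {1..n+1}" "transpose a b \<notin> S"
  obtains A where "A \<subseteq> {1..n+1}" "a \<in> A" "b \<in> A"
    "\<And>c d. transpose c d \<in> S \<Longrightarrow> c \<noteq> d \<Longrightarrow> c \<in> A \<longleftrightarrow> d \<notin> A"
proof
  define A where "A = {a, b} \<union> {c \<in> {1..n+1}. \<exists>d. transpose c d \<in> S \<and> c < d \<and> d \<notin> {a, b}}"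
  show "A \<subseteq> {1..n+1}" "a \<in> A" "b \<in> A" using ab by (auto simp: A_def)
  have uniq: "d = e" if "transpose c d \<in> S" "transpose c e \<in> S" "c \<noteq> d" "c \<noteq> e" for c d e
    using commuting_transpositions_disjoint[of c d e] S(2) that by blast
  have range: "c \<in> {1..n+1}" if "transpose c d \<in> S" "c \<noteq> d" for c d
  proof -
    obtain x y where "transpose c d = transpose x y" "x \<in> {1..n+1}" "y \<in> {1..n+1}"
      using reflectionsE[of "transpose c d" n] S(1) \<open>transpose c d \<in> S\<close> by blast
    then show ?thesis using that(2) by (metis transpose_apply_first transpose_apply_other)
  qed
  have lt: "c \<in> A \<longleftrightarrow> d \<notin> A" if cd: "transpose c d \<in> S" "c < d" for c d
  proof -
    have only_d: "e = d" if "transpose c e \<in> S" "c < e" for e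
      using uniq[OF cd(1) that(1)] cd(2) that(2) by simp
    have only_c: "e = c" if "transpose d e \<in> S" "d < e" for e
      using uniq[of d c e] cd that by (simp add: transpose_commute)
    have c: "c \<in> A \<longleftrightarrow> c \<in> {a, b} \<or> d \<notin> {a, b}"
      using cd only_d range[OF cd(1)] unfolding A_def by blast
    have d: "d \<in> A \<longleftrightarrow> d \<in> {a, b}"
      using cd only_c unfolding A_def by auto
    have "\<not> (c \<in> {a, b} \<and> d \<in> {a, b})"
      using cd ab(3) transpose_commute[of a b] by auto
    then show ?thesis using c d by blast
  qed
  show "c \<in> A \<longleftrightarrow> d \<notin> A" if "transpose c d \<in> S" "c \<noteq> d" for c d
  proof (cases "c < d")
    case True
    then show ?thesis using lt that by blast
  next
    case False
    then have "d \<in> A \<longleftrightarrow> c \<notin> A"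
      using that by (intro lt) (auto simp: transpose_commute)
    then show ?thesis by blast
  qed
qed

text \<open>
  If \<open>(a b)\<close> is not in \<open>S\<close>, the cut given by a colouring as above, which is proper since \<open>S\<close> is
  nonempty, yields a Weyl line that is transverse to all of \<open>S\<close> but not to \<open>(a b)\<close>.
\<close>

lemma mem_commuting_iff:
  assumes S: "S \<subseteq> reflections n" "S \<noteq> {}" "\<forall>s\<in>S. \<forall>t\<in>S. s \<circ> t = t \<circ> s"
    and t: "t \<in> reflections n"
  shows "t \<in> S \<longleftrightarrow> (\<Inter>s\<in>S. V_refl n s) \<subseteq> (V_refl n t :: (nat \<Rightarrow> 'k::field_char_0) set)"
proof
  assume sub: "(\<Inter>s\<in>S. V_refl n s) \<subseteq> (V_refl n t :: (nat \<Rightarrow> 'k) set)"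
  obtain a b where ab: "t = transpose a b" "a \<in> {1..n+1}" "b \<in> {1..n+1}" "a \<noteq> b"
    using reflectionsE[OF t] by blast
  show "t \<in> S"
  proof (rule ccontr)
    assume "t \<notin> S"
    then obtain A where A: "A \<subseteq> {1..n+1}" "a \<in> A" "b \<in> A"
      "\<And>c d. transpose c d \<in> S \<Longrightarrow> c \<noteq> d \<Longrightarrow> c \<in> A \<longleftrightarrow> d \<notin> A"
      using separating_coloring[OF S(1,3) ab(2,3)] ab(1) by metis
    define v :: "nat \<Rightarrow> 'k" where "v = cut_vector n A"
    have v: "v \<in> two_valued n" unfolding v_def by (rule cut_vector_two_valued[OF A(1)])
    have sep: "\<exists>c d. s = transpose c d \<and> c \<in> {1..n+1} \<and> d \<in> {1..n+1} \<and> c \<noteq> d \<and> v c \<noteq> v d"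
      if "s \<in> S" for s
    proof -
      obtain c d where "s = transpose c d" "c \<in> {1..n+1}" "d \<in> {1..n+1}" "c \<noteq> d"
        using reflectionsE[of s n] S(1) \<open>s \<in> S\<close> by blast
      then show ?thesis using A(4)[of c d] that cut_vector_eq_iff[OF A(1), of c d]
        unfolding v_def by blast
    qed
    have "v \<in> (\<Inter>s\<in>S. V_refl n s)"
    proof
      fix s assume "s \<in> S"
      then obtain c d where "s = transpose c d" "c \<in> {1..n+1}" "d \<in> {1..n+1}" "c \<noteq> d" "v c \<noteq> v d"
        using sep by blast
      then show "v \<in> V_refl n s" using v by (simp add: V_refl_transpose)
    qed
    then have "v \<in> V_refl n (transpose a b)" using sub ab(1) by blast
    moreover have "v a = v b" using A ab by (simp add: v_def cut_vector_eq_iff)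
    moreover have "v \<noteq> 0" using S(2) sep by force
    ultimately show False using ab by (simp add: V_refl_transpose)
  qed
next
  assume "t \<in> S"
  then show "(\<Inter>s\<in>S. V_refl n s) \<subseteq> (V_refl n t :: (nat \<Rightarrow> 'k) set)" by (rule INT_lower)
qed

lemma commuting_set_unique:
  assumes "S \<subseteq> reflections n" "S \<noteq> {}" "\<forall>s\<in>S. \<forall>t\<in>S. s \<circ> t = t \<circ> s"
    and "S' \<subseteq> reflections n" "S' \<noteq> {}" "\<forall>s\<in>S'. \<forall>t\<in>S'. s \<circ> t = t \<circ> s"
    and eq: "(\<Inter>s\<in>S. V_refl n s) = (\<Inter>s\<in>S'. V_refl n s :: (nat \<Rightarrow> 'k::field_char_0) set)"
  shows "S = S'"
proof -
  have "t \<in> S \<longleftrightarrow> t \<in> S'" if "t \<in> reflections n" for t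
    using mem_commuting_iff[OF assms(1-3) that, where 'k='k]
      mem_commuting_iff[OF assms(4-6) that, where 'k='k] eq by simp
  then show ?thesis using assms(1,4) by blast
qed


section \<open>Perfect matchings of the boundary points\<close>

text \<open>
  Planarity enters only when the surgery below is shown to create no crossing; the shape of products
  depends on the matching alone.
\<close>

definition matching :: "nat \<Rightarrow> diagram \<Rightarrow> bool" where
  "matching n d \<longleftrightarrow> partition_on (points n) d \<and> (\<forall>A\<in>d. card A = 2)"

lemma points_simps [simp]: "Top j \<in> points n \<longleftrightarrow> j \<in> {1..n+1}" "Bot j \<in> points n \<longleftrightarrow> j \<in> {1..n+1}"
  by (auto simp: points_def)

lemma matchingI:
  assumes "\<And>A. A \<in> d \<Longrightarrow> card A = 2 \<and> A \<subseteq> points n"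
    and "\<And>p. p \<in> points n \<Longrightarrow> \<exists>A\<in>d. p \<in> A"
    and "\<And>A B p. A \<in> d \<Longrightarrow> B \<in> d \<Longrightarrow> p \<in> A \<Longrightarrow> p \<in> B \<Longrightarrow> A = B"
  shows "matching n d"
  unfolding matching_def
proof (intro conjI partition_onI)
  show "\<Union>d = points n" using assms(1,2) by blast
  show "disjnt A B" if "A \<in> d" "B \<in> d" "A \<noteq> B" for A B
    using assms(3) that unfolding disjnt_def by blast
  show "{} \<notin> d" using assms(1) by fastforce
  show "\<forall>A\<in>d. card A = 2" using assms(1) by blast
qed

lemma matching_unique:
  assumes "matching n d" "A \<in> d" "B \<in> d" "p \<in> A" "p \<in> B"
  shows "A = B"
  using assms disjointD[OF partition_onD2, of "points n" d A B] unfolding matching_def by blast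

lemma matching_arc:
  assumes "matching n d" "A \<in> d"
  shows "card A = 2" "A \<subseteq> points n"
  using assms partition_onD1[of "points n" d] by (auto simp: matching_def)

lemma matching_partner:
  assumes "matching n d" "p \<in> points n"
  obtains q where "{p, q} \<in> d" "p \<noteq> q" "q \<in> points n"
proof -
  obtain A where A: "A \<in> d" "p \<in> A"
    using assms partition_onD1[of "points n" d] by (auto simp: matching_def)
  then obtain q where "A = {p, q}" "p \<noteq> q"
    using matching_arc(1)[OF assms(1) A(1)] by (auto simp: card_2_iff)
  then show ?thesis using that matching_arc(2)[OF assms(1) A(1)] A(1) by blast
qed

lemma matching_endpoints:
  assumes "matching n d" "{p, q} \<in> d"
  shows "p \<noteq> q" "p \<in> points n" "q \<in> points n"
  using matching_arc[OF assms] by (auto simp: card_2_iff doubleton_eq_iff)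


section \<open>Multiplication by a generator\<close>

definition gen_diagram :: "nat \<Rightarrow> nat \<Rightarrow> diagram" where
  "gen_diagram n i =
     {{Top i, Top (i + 1)}, {Bot i, Bot (i + 1)}} \<union>
       {{Top j, Bot j} | j. j \<in> {1..n+1} \<and> j \<noteq> i \<and> j \<noteq> i + 1}"

text \<open>
  For a matching \<open>e\<close> this is the arc at \<open>p\<close>, and \<open>{p}\<close> for \<open>p\<close> outside \<open>points n\<close>, so that two
  different points are joined in \<open>e\<close> iff their blocks agree, without a restriction to \<open>points n\<close>.
\<close>

definition block :: "diagram \<Rightarrow> point \<Rightarrow> point set" where
  "block e p = insert p (\<Union>{A \<in> e. p \<in> A})"

lemma block_eq:
  assumes "matching n e" "A \<in> e" "p \<in> A"
  shows "block e p = A"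
  using assms matching_unique[OF assms(1)] unfolding block_def by blast

lemma mem_of_block:
  assumes "matching n e" "q \<in> block e p" "p \<noteq> q"
  shows "{p, q} \<in> e"
proof -
  obtain A where A: "A \<in> e" "p \<in> A" "q \<in> A" using assms(2,3) by (auto simp: block_def)
  then have "A = {p, q}" using matching_arc(1)[OF assms(1)] assms(3) by (auto simp: card_2_iff)
  then show ?thesis using A(1) by simp
qed

lemma connected_in_stack_edge:
  "{x, y} \<in> stack d e \<Longrightarrow> connected_in_stack d e x y"
  unfolding connected_in_stack_def by blast

lemma connected_in_stack_trans:
  "connected_in_stack d e x y \<Longrightarrow> connected_in_stack d e y z \<Longrightarrow> connected_in_stack d e x z"
  unfolding connected_in_stack_def by simp

lemma connected_in_stack_sym:
  "connected_in_stack d e x y \<Longrightarrow> connected_in_stack d e y x"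
  unfolding connected_in_stack_def
  by (rule sympD[OF symp_rtranclp]) (auto simp: symp_def insert_commute)

lemma connected_in_stack_invariant:
  assumes "\<And>A x y. A \<in> stack d e \<Longrightarrow> x \<in> A \<Longrightarrow> y \<in> A \<Longrightarrow> h x = h y"
    and "connected_in_stack d e x y"
  shows "h x = h y"
  using assms(2) unfolding connected_in_stack_def
  by (induction rule: rtranclp_induct) (use assms(1) in \<open>auto\<close>)

text \<open>
  The connected components of the stack are bounded from below by exhibiting paths (\<open>join\<close>) and from
  above by a labelling that is constant along edges. The labels are blocks of the expected product
  \<open>e\<close>: each strand carries the block that it is going to be part of. The function \<open>l\<close> labels the
  points of \<open>d\<close>. Away from \<open>i\<close> and \<open>i + 1\<close> vertical lines force the label of a middle point to be
  the block of the top point above it, whereas the labels at \<open>i\<close> and \<open>i + 1\<close> need only be equal,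
  because of the lower arc of the generator.
\<close>

lemma diagram_comp_gen_eqI:
  assumes d: "matching n d" and e: "matching n e"
    and join: "\<And>p q. {p, q} \<in> e \<Longrightarrow>
                 connected_in_stack (gen_diagram n i) d (outer p) (outer q)"
    and cap: "{Top i, Top (i + 1)} \<in> e"
    and label: "\<And>p q. {p, q} \<in> d \<Longrightarrow> l p = l q"
    and label_other: "\<And>p. p \<noteq> Top i \<Longrightarrow> p \<noteq> Top (i + 1) \<Longrightarrow> l p = block e p"
    and label_cup: "l (Top i) = l (Top (i + 1))"
  shows "diagram_comp (gen_diagram n i) d = e"
proof -
  define h where "h x = (case x of Upper j \<Rightarrow> block e (Top j) | Middle j \<Rightarrow> l (Top j)
    | Lower j \<Rightarrow> block e (Bot j))" for x
  have h_outer: "h (outer p) = block e p" for p by (cases p) (auto simp: h_def)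
  have h_lower: "h (lower_half p) = l p" for p by (cases p) (auto simp: h_def label_other)
  have h_edge: "h x = h y"
    if A: "A \<in> stack (gen_diagram n i) d" "x \<in> A" "y \<in> A" for A x y
  proof -
    from A(1) consider B where "B \<in> gen_diagram n i" "A = upper_half ` B"
      | B where "B \<in> d" "A = lower_half ` B"
      by (auto simp: stack_def)
    then show ?thesis
    proof cases
      case 1
      have "block e (Top i) = block e (Top (i + 1))"
        using block_eq[OF e cap] by simp
      then show ?thesis using 1 A(2,3) label_cup label_other
        by (auto simp: gen_diagram_def h_def)
    next
      case 2
      then obtain p q where "B = {p, q}" using matching_arc(1)[OF d] by (metis card_2_iff)
      then show ?thesis using 2 A(2,3) label[of p q] by (auto simp: h_lower)
    qed
  qed
  show ?thesis
  proof (intro equalityI subsetI)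
    fix A assume "A \<in> diagram_comp (gen_diagram n i) d"
    then obtain p q where A: "A = {p, q}" "p \<noteq> q"
      "connected_in_stack (gen_diagram n i) d (outer p) (outer q)"
      by (auto simp: diagram_comp_def)
    have "block e p = block e q"
      using connected_in_stack_invariant[of _ d h, OF h_edge A(3)] by (simp add: h_outer)
    then have "q \<in> block e p" by (simp add: block_def)
    then show "A \<in> e" using mem_of_block[OF e _ A(2)] A(1) by simp
  next
    fix A assume "A \<in> e"
    moreover obtain p q where "A = {p, q}" "p \<noteq> q"
      using matching_arc(1)[OF e \<open>A \<in> e\<close>] by (auto simp: card_2_iff)
    ultimately show "A \<in> diagram_comp (gen_diagram n i) d"
      using join unfolding diagram_comp_def by blast
  qed
qed

lemma stack_gen_lower: "{p, q} \<in> d \<Longrightarrow> {lower_half p, lower_half q} \<in> stack (gen_diagram n i) d"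
  unfolding stack_def by (auto intro!: image_eqI[of _ _ "{p, q}"])

lemma stack_gen_vertical:
  "j \<in> {1..n+1} \<Longrightarrow> j \<noteq> i \<Longrightarrow> j \<noteq> i + 1 \<Longrightarrow> {Upper j, Middle j} \<in> stack (gen_diagram n i) d"
  unfolding stack_def gen_diagram_def
  by (rule UnI1, rule image_eqI[of _ _ "{Top j, Bot j}"]) auto

lemma stack_gen_cap: "{Upper i, Upper (i + 1)} \<in> stack (gen_diagram n i) d"
  unfolding stack_def gen_diagram_def
  by (rule UnI1, rule image_eqI[of _ _ "{Top i, Top (i + 1)}"]) auto

lemma stack_gen_cup: "{Middle i, Middle (i + 1)} \<in> stack (gen_diagram n i) d"
  unfolding stack_def gen_diagram_def
  by (rule UnI1, rule image_eqI[of _ _ "{Bot i, Bot (i + 1)}"]) auto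

lemma connected_outer_lower:
  assumes "p \<in> points n" "p \<noteq> Top i" "p \<noteq> Top (i + 1)"
  shows "connected_in_stack (gen_diagram n i) d (outer p) (lower_half p)"
proof (cases p)
  case (Top j)
  then show ?thesis using assms by (auto intro!: connected_in_stack_edge stack_gen_vertical)
next
  case (Bot j)
  then show ?thesis by (simp add: connected_in_stack_def)
qed

lemma connected_old_arc:
  assumes "matching n d" "{p, q} \<in> d" "{p, q} \<inter> {Top i, Top (i + 1)} = {}"
  shows "connected_in_stack (gen_diagram n i) d (outer p) (outer q)"
proof -
  have "connected_in_stack (gen_diagram n i) d (outer p) (lower_half p)"
    "connected_in_stack (gen_diagram n i) d (outer q) (lower_half q)"
    using matching_endpoints[OF assms(1,2)] assms(3) by (auto intro!: connected_outer_lower)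
  moreover have "connected_in_stack (gen_diagram n i) d (lower_half p) (lower_half q)"
    using stack_gen_lower[OF assms(2)] by (rule connected_in_stack_edge)
  ultimately show ?thesis
    by (meson connected_in_stack_trans connected_in_stack_sym)
qed

lemma connected_cap:
  assumes "{p, q} = {Top i, Top (i + 1)}"
  shows "connected_in_stack (gen_diagram n i) d (outer p) (outer q)"
  using assms connected_in_stack_edge[OF stack_gen_cap, of n i d]
  by (auto simp: doubleton_eq_iff connected_in_stack_sym)

text \<open>
  The component of the middle points \<open>i\<close> and \<open>i + 1\<close> is a closed circle, which is dropped, and the
  upper arc of the generator takes the place of the arc of \<open>d\<close>.
\<close>

lemma gen_comp_loop:
  assumes d: "matching n d" and loop: "{Top i, Top (i + 1)} \<in> d"
  shows "diagram_comp (gen_diagram n i) d = d"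
proof (rule diagram_comp_gen_eqI[OF d d, of i "\<lambda>p. block d p"])
  fix p q assume pq: "{p, q} \<in> d"
  show "connected_in_stack (gen_diagram n i) d (outer p) (outer q)"
  proof (cases "{p, q} = {Top i, Top (i + 1)}")
    case True
    then show ?thesis by (rule connected_cap)
  next
    case False
    then have "{p, q} \<inter> {Top i, Top (i + 1)} = {}"
      using matching_unique[OF d pq loop] by blast
    then show ?thesis by (rule connected_old_arc[OF d pq])
  qed
  show "block d p = block d q" using block_eq[OF d pq] by simp
next
  show "block d (Top i) = block d (Top (i + 1))" using block_eq[OF d loop] by simp
qed (use loop in auto)

definition rewire :: "nat \<Rightarrow> point \<Rightarrow> point \<Rightarrow> diagram \<Rightarrow> diagram" where
  "rewire i p q d =
     {{Top i, Top (i + 1)}, {p, q}} \<union> (d - {{Top i, p}, {Top (i + 1), q}})"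

context
  fixes n i d p q
  assumes d: "matching n d"
    and arcs: "{Top i, p} \<in> d" "{Top (i + 1), q} \<in> d"
    and no_loop: "{Top i, Top (i + 1)} \<notin> d"
begin

lemma rewire_distinct:
  "p \<noteq> Top i" "p \<noteq> Top (i + 1)" "q \<noteq> Top i" "q \<noteq> Top (i + 1)" "p \<noteq> q"
proof -
  show "p \<noteq> Top i" "p \<noteq> Top (i + 1)" "q \<noteq> Top i" "q \<noteq> Top (i + 1)"
    using matching_endpoints(1)[OF d arcs(1)] matching_endpoints(1)[OF d arcs(2)] no_loop arcs
    by (auto simp: insert_commute)
  show "p \<noteq> q" using matching_unique[OF d arcs, of p] \<open>p \<noteq> Top i\<close> \<open>p \<noteq> Top (i + 1)\<close>
    by (auto simp: doubleton_eq_iff)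
qed

lemma kept_arc:
  assumes "A \<in> d - {{Top i, p}, {Top (i + 1), q}}"
  shows "A \<inter> {Top i, Top (i + 1), p, q} = {}"
  using assms matching_unique[OF d _ arcs(1)] matching_unique[OF d _ arcs(2)] by blast

lemma rewire_matching: "matching n (rewire i p q d)"
proof (rule matchingI)
  note ends = matching_endpoints[OF d arcs(1)] matching_endpoints[OF d arcs(2)]
  show "card A = 2 \<and> A \<subseteq> points n" if "A \<in> rewire i p q d" for A
    using that rewire_distinct(5) ends matching_arc[OF d, of A] by (auto simp: rewire_def)
  show "\<exists>A\<in>rewire i p q d. x \<in> A" if x: "x \<in> points n" for x
  proof (cases "x \<in> {Top i, Top (i + 1), p, q}")
    case False
    obtain y where "{x, y} \<in> d" using matching_partner[OF d x] by metis
    then have "{x, y} \<in> rewire i p q d" using False by (auto simp: rewire_def doubleton_eq_iff)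
    then show ?thesis by blast
  qed (auto simp: rewire_def)
  show "A = B" if AB: "A \<in> rewire i p q d" "B \<in> rewire i p q d" "x \<in> A" "x \<in> B" for A B x
  proof -
    show ?thesis
    proof (cases "x \<in> {Top i, Top (i + 1), p, q}")
      case True
      have "C = (if x \<in> {p, q} then {p, q} else {Top i, Top (i + 1)})"
        if C: "C \<in> rewire i p q d" "x \<in> C" for C
      proof -
        have "C \<notin> d - {{Top i, p}, {Top (i + 1), q}}" using True C(2) kept_arc by blast
        then have "C = {Top i, Top (i + 1)} \<or> C = {p, q}"
          using C(1) unfolding rewire_def by (elim UnE) auto
        then show ?thesis using C(2) rewire_distinct by (elim disjE) auto
      qed
      then show ?thesis using AB by metis
    next
      case False
      then have "A \<in> d" "B \<in> d" using AB unfolding rewire_def by (elim UnE; auto)+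
      then show ?thesis using matching_unique[OF d] AB(3,4) by blast
    qed
  qed
qed

text \<open>
  The partners \<open>p\<close> and \<open>q\<close> become connected through the lower arc of the generator, so the middle
  points \<open>i\<close> and \<open>i + 1\<close> are labelled with \<open>{p, q}\<close>.
\<close>

lemma gen_comp_rewire: "diagram_comp (gen_diagram n i) d = rewire i p q d"
proof -
  let ?e = "rewire i p q d"
  define l where "l x = (if x \<in> {Top i, Top (i + 1)} then {p, q} else block ?e x)" for x
  note e = rewire_matching
  note ends = matching_endpoints[OF d arcs(1)] matching_endpoints[OF d arcs(2)]
  have pq_block: "block ?e p = {p, q}" "block ?e q = {p, q}"
    by (rule block_eq[OF e]; simp add: rewire_def)+
  have conn: "connected_in_stack (gen_diagram n i) d (outer p) (outer q)"
  proof -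
    let ?c = "connected_in_stack (gen_diagram n i) d"
    have "?c (outer p) (lower_half p)" "?c (outer q) (lower_half q)"
      using connected_outer_lower ends rewire_distinct by blast+
    moreover have "?c (Middle i) (lower_half p)" "?c (Middle (i + 1)) (lower_half q)"
      using connected_in_stack_edge[OF stack_gen_lower[OF arcs(1)]]
        connected_in_stack_edge[OF stack_gen_lower[OF arcs(2)]] by simp_all
    moreover have "?c (Middle i) (Middle (i + 1))"
      by (rule connected_in_stack_edge[OF stack_gen_cup])
    ultimately show ?thesis by (meson connected_in_stack_trans connected_in_stack_sym)
  qed
  show ?thesis
  proof (rule diagram_comp_gen_eqI[OF d e, of i l])
    fix x y assume xy: "{x, y} \<in> ?e"
    then consider "{x, y} = {Top i, Top (i + 1)}" | "{x, y} = {p, q}"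
      | "{x, y} \<in> d - {{Top i, p}, {Top (i + 1), q}}"
      unfolding rewire_def by blast
    then show "connected_in_stack (gen_diagram n i) d (outer x) (outer y)"
    proof cases
      case 1
      then show ?thesis by (rule connected_cap)
    next
      case 2
      then show ?thesis using conn connected_in_stack_sym by (auto simp: doubleton_eq_iff)
    next
      case 3
      then show ?thesis using connected_old_arc[OF d] kept_arc[OF 3] by blast
    qed
  next
    fix x y assume xy: "{x, y} \<in> d"
    show "l x = l y"
    proof (cases "{x, y} \<in> {{Top i, p}, {Top (i + 1), q}}")
      case True
      then have "{x, y} = {Top i, p} \<or> {x, y} = {Top (i + 1), q}" by simp
      then show ?thesis
        using rewire_distinct pq_block unfolding doubleton_eq_iff l_def by auto
    next
      case False
      then have "{x, y} \<in> ?e" using xy by (auto simp: rewire_def)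
      then have "block ?e x = block ?e y" using block_eq[OF e, of "{x, y}"] by simp
      moreover have "x \<notin> {Top i, Top (i + 1)}" "y \<notin> {Top i, Top (i + 1)}"
        using kept_arc[of "{x, y}"] xy False by blast+
      ultimately show ?thesis by (simp add: l_def)
    qed
  qed (auto simp: l_def rewire_def)
qed

end


section \<open>Planarity\<close>

lemma planar_matching: "planar_diagram n d \<Longrightarrow> matching n d"
  by (simp add: planar_diagram_def matching_def)

lemma boundary_pos_inj:
  assumes "p \<in> points n" "q \<in> points n" "boundary_pos n p = boundary_pos n q"
  shows "p = q"
  using assms by (cases p; cases q) auto

lemma planar_no_crossing:
  assumes "planar_diagram n d" "{p, q} \<in> d" "{r, s} \<in> d"
  shows "\<not> (boundary_pos n p < boundary_pos n r \<and> boundary_pos n r < boundary_pos n q \<and>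
            boundary_pos n q < boundary_pos n s)"
  using assms unfolding planar_diagram_def by blast

text \<open>
  Here \<open>x\<close> and \<open>x + 1\<close> stand for the positions of the top points \<open>i\<close> and \<open>i + 1\<close>. Since \<open>r\<close> and \<open>s\<close>
  avoid these, the arc \<open>{r, s}\<close> has both of them on the same side. It crosses neither \<open>{x, p}\<close> nor
  \<open>{x + 1, q}\<close>, so \<open>p\<close> and \<open>q\<close> lie on that side too, and \<open>{r, s}\<close> does not cross \<open>{p, q}\<close>. The four
  conclusions are the orders in which such a crossing could occur.
\<close>

lemma noncrossing_surgery:
  fixes x p q r s :: nat
  assumes rs: "r \<noteq> x" "r \<noteq> x + 1" "s \<noteq> x" "s \<noteq> x + 1"
    and p: "\<not> (x < r \<and> r < p \<and> p < s)" "\<not> (p < r \<and> r < x \<and> x < s)"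
      "\<not> (r < x \<and> x < s \<and> s < p)" "\<not> (r < p \<and> p < s \<and> s < x)"
    and q: "\<not> (x + 1 < r \<and> r < q \<and> q < s)" "\<not> (q < r \<and> r < x + 1 \<and> x + 1 < s)"
      "\<not> (r < x + 1 \<and> x + 1 < s \<and> s < q)" "\<not> (r < q \<and> q < s \<and> s < x + 1)"
  shows "\<not> (p < r \<and> r < q \<and> q < s)" "\<not> (r < p \<and> p < s \<and> s < q)"
    "\<not> (q < r \<and> r < p \<and> p < s)" "\<not> (r < q \<and> q < s \<and> s < p)"
proof -
  \<comment> \<open>The arc has both \<open>x\<close> and \<open>x + 1\<close> to its left, within it, or to its right.\<close>
  consider "x + 1 < r" | "r < x" "x + 1 < s" | "r < x" "s < x" using rs by linarith
  note pos = this
  show "\<not> (p < r \<and> r < q \<and> q < s)" by (cases rule: pos) (use p(2) q(1,4) in linarith)+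
  show "\<not> (r < p \<and> p < s \<and> s < q)" by (cases rule: pos) (use p(1,4) q(3) in linarith)+
  show "\<not> (q < r \<and> r < p \<and> p < s)" by (cases rule: pos) (use p(1,4) q(2) in linarith)+
  show "\<not> (r < q \<and> q < s \<and> s < p)" by (cases rule: pos) (use p(3) q(1,4) in linarith)+
qed

text \<open>
  The new arc \<open>{Top i, Top (i + 1)}\<close> joins neighbouring boundary positions and is crossed by nothing;
  for \<open>{p, q}\<close> there is \<open>noncrossing_surgery\<close>.
\<close>

lemma rewire_planar:
  assumes planar: "planar_diagram n d"
    and arcs: "{Top i, p} \<in> d" "{Top (i + 1), q} \<in> d"
    and no_loop: "{Top i, Top (i + 1)} \<notin> d"
  shows "planar_diagram n (rewire i p q d)"
proof -
  note d = planar_matching[OF planar]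
  define e where "e = rewire i p q d"
  define K where "K = d - {{Top i, p}, {Top (i + 1), q}}"
  have kept: "R \<notin> {Top i, Top (i + 1), p, q}" "S \<notin> {Top i, Top (i + 1), p, q}"
    if "{R, S} \<in> K" for R S
    using kept_arc[OF d arcs no_loop, of "{R, S}"] that unfolding K_def by blast+
  let ?b = "boundary_pos n"
  have surgery:
    "\<not> (?b p < ?b R \<and> ?b R < ?b q \<and> ?b q < ?b S)" "\<not> (?b R < ?b p \<and> ?b p < ?b S \<and> ?b S < ?b q)"
    "\<not> (?b q < ?b R \<and> ?b R < ?b p \<and> ?b p < ?b S)" "\<not> (?b R < ?b q \<and> ?b q < ?b S \<and> ?b S < ?b p)"
    if RS: "{R, S} \<in> K" for R S
  proof -
    have RSd: "{R, S} \<in> d" using RS by (simp add: K_def)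
    have arcs': "{p, Top i} \<in> d" "{q, Top (i + 1)} \<in> d" using arcs by (simp_all add: insert_commute)
    have ends: "R \<in> points n" "S \<in> points n" "Top i \<in> points n" "Top (i + 1) \<in> points n"
      using matching_endpoints[OF d] RSd arcs by blast+
    have ne: "?b R \<noteq> i" "?b R \<noteq> i + 1" "?b S \<noteq> i" "?b S \<noteq> i + 1"
      using boundary_pos_inj[OF ends(1,3)] boundary_pos_inj[OF ends(1,4)]
        boundary_pos_inj[OF ends(2,3)] boundary_pos_inj[OF ends(2,4)] kept[OF RS] by auto
    note nc = planar_no_crossing[OF planar]
    have x: "?b (Top i) = i" "?b (Top (i + 1)) = i + 1" by simp_all
    show
      "\<not> (?b p < ?b R \<and> ?b R < ?b q \<and> ?b q < ?b S)" "\<not> (?b R < ?b p \<and> ?b p < ?b S \<and> ?b S < ?b q)"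
      "\<not> (?b q < ?b R \<and> ?b R < ?b p \<and> ?b p < ?b S)" "\<not> (?b R < ?b q \<and> ?b q < ?b S \<and> ?b S < ?b p)"
      using noncrossing_surgery[OF ne
          nc[OF arcs(1) RSd, unfolded x] nc[OF arcs'(1) RSd, unfolded x]
          nc[OF RSd arcs(1), unfolded x] nc[OF RSd arcs'(1), unfolded x]
          nc[OF arcs(2) RSd, unfolded x] nc[OF arcs'(2) RSd, unfolded x]
          nc[OF RSd arcs(2), unfolded x] nc[OF RSd arcs'(2), unfolded x]]
      by blast+
  qed
  have no_cross: "\<not> (?b P < ?b R \<and> ?b R < ?b Q \<and> ?b Q < ?b S)"
    if PQ: "{P, Q} \<in> e" and RS: "{R, S} \<in> e" for P Q R S
  proof
    assume cross: "?b P < ?b R \<and> ?b R < ?b Q \<and> ?b Q < ?b S"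
    have split: "A = {Top i, Top (i + 1)} \<or> A = {p, q} \<or> A \<in> K" if "A \<in> e" for A
      using that unfolding e_def rewire_def K_def by blast
    have "{P, Q} \<noteq> {Top i, Top (i + 1)}" "{R, S} \<noteq> {Top i, Top (i + 1)}"
      using cross unfolding doubleton_eq_iff by auto
    then have "{P, Q} = {p, q} \<or> {P, Q} \<in> K" "{R, S} = {p, q} \<or> {R, S} \<in> K"
      using split[OF PQ] split[OF RS] by argo+
    then consider "{P, Q} = {p, q}" "{R, S} = {p, q}" | "{P, Q} = {p, q}" "{R, S} \<in> K"
      | "{P, Q} \<in> K" "{R, S} = {p, q}" | "{P, Q} \<in> K" "{R, S} \<in> K"
      by argo
    then show False
    proof cases
      case 1
      then show False using cross unfolding doubleton_eq_iff by auto
    next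
      case 2
      then have "P = p \<and> Q = q \<or> P = q \<and> Q = p" by (simp add: doubleton_eq_iff)
      then show False using cross surgery(1,3)[OF 2(2)] by blast
    next
      case 3
      then have "R = p \<and> S = q \<or> R = q \<and> S = p" by (simp add: doubleton_eq_iff)
      then show False using cross surgery(2,4)[OF 3(1)] by blast
    next
      case 4
      then have "{P, Q} \<in> d" "{R, S} \<in> d" by (simp_all add: K_def)
      then show False using cross planar_no_crossing[OF planar] by blast
    qed
  qed
  show ?thesis
    using rewire_matching[OF d arcs no_loop] no_cross
    unfolding planar_diagram_def matching_def e_def by blast
qed

lemma gen_comp_cases:
  assumes "planar_diagram n d" "i \<in> {1..n}"
  obtains (loop) "{Top i, Top (i + 1)} \<in> d" "diagram_comp (gen_diagram n i) d = d"
  | (rewire) p q where "{Top i, p} \<in> d" "{Top (i + 1), q} \<in> d" "{Top i, Top (i + 1)} \<notin> d"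
      "diagram_comp (gen_diagram n i) d = rewire i p q d"
proof (cases "{Top i, Top (i + 1)} \<in> d")
  case True
  then show ?thesis using loop gen_comp_loop[OF planar_matching[OF assms(1)]] by blast
next
  case False
  note d = planar_matching[OF assms(1)]
  obtain p where p: "{Top i, p} \<in> d"
    using matching_partner[OF d, of "Top i"] assms(2) by auto
  obtain q where q: "{Top (i + 1), q} \<in> d"
    using matching_partner[OF d, of "Top (i + 1)"] assms(2) by auto
  show ?thesis using rewire[OF p q False gen_comp_rewire[OF d p q False]] .
qed

lemma gen_comp_planar:
  assumes "planar_diagram n d" "i \<in> {1..n}"
  shows "planar_diagram n (diagram_comp (gen_diagram n i) d)"
  using assms
proof (cases rule: gen_comp_cases)
  case (rewire p q)
  then show ?thesis using rewire_planar[OF assms(1)] by simp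
qed (use assms in simp)


section \<open>The diagram of a word\<close>

fun word_diagram :: "nat \<Rightarrow> nat list \<Rightarrow> diagram" where
  "word_diagram n [] = {{Top j, Bot j} | j. j \<in> {1..n+1}}"
| "word_diagram n (i # ws) = diagram_comp (gen_diagram n i) (word_diagram n ws)"

lemma identity_planar: "planar_diagram n (word_diagram n [])"
proof -
  have "matching n (word_diagram n [])"
  proof (rule matchingI)
    show "\<exists>A\<in>word_diagram n []. p \<in> A" if "p \<in> points n" for p
      using that by (cases p) auto
  qed auto
  moreover have "\<not> (boundary_pos n p < boundary_pos n r \<and> boundary_pos n r < boundary_pos n q \<and>
      boundary_pos n q < boundary_pos n s)"
    if "{p, q} \<in> word_diagram n []" "{r, s} \<in> word_diagram n []" for p q r s
    using that by (auto simp: doubleton_eq_iff)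
  ultimately show ?thesis unfolding planar_diagram_def matching_def by blast
qed

lemma word_diagram_planar: "set ws \<subseteq> {1..n} \<Longrightarrow> planar_diagram n (word_diagram n ws)"
proof (induction ws)
  case (Cons i ws)
  then show ?case using gen_comp_planar[of n "word_diagram n ws" i] by simp
qed (rule identity_planar)

lemma circle_factor_nonzero: "circle_factor \<noteq> 0"
proof
  assume "circle_factor = 0"
  then have "Poly_Mapping.lookup circle_factor (-2) = 0" by simp
  then show False by (simp add: circle_factor_def lookup_add lookup_single lookup_one)
qed

lemma tl_mult_single:
  assumes "a \<noteq> 0" "b \<noteq> 0"
  shows "tl_mult n (Poly_Mapping.single d a) (Poly_Mapping.single e b) =
    Poly_Mapping.single (diagram_comp d e) (a * b * circle_factor ^ circles n d e)"
  using assms by (simp add: tl_mult_def)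

text \<open>
  Every circle contributes \<open>circle_factor\<close>, and the Laurent polynomials form an integral domain, so
  the coefficient stays nonzero.
\<close>

lemma b_word_single: "\<exists>c. c \<noteq> 0 \<and> b_word n ws = Poly_Mapping.single (word_diagram n ws) c"
proof (induction ws)
  case Nil
  show ?case by (rule exI[of _ 1]) (simp add: b_word_def tl_one_def)
next
  case (Cons i ws)
  then obtain c where c: "c \<noteq> 0" "b_word n ws = Poly_Mapping.single (word_diagram n ws) c" by blast
  have "b_word n (i # ws) = tl_mult n (Poly_Mapping.single (gen_diagram n i) 1) (b_word n ws)"
    by (simp add: b_word_def tl_gen_def gen_diagram_def)
  also have "\<dots> = Poly_Mapping.single (word_diagram n (i # ws))
      (c * circle_factor ^ circles n (gen_diagram n i) (word_diagram n ws))"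
    using c by (simp add: tl_mult_single)
  finally show ?case using c(1) circle_factor_nonzero by (metis mult_eq_0_iff power_eq_0_iff)
qed

lemma Q_word_eq:
  assumes "set ws \<subseteq> {1..n}"
  shows "Q_word n ws = {transpose a b | a b. {Top a, Top b} \<in> word_diagram n ws}"
proof -
  obtain c where "c \<noteq> 0" "b_word n ws = Poly_Mapping.single (word_diagram n ws) c"
    using b_word_single by blast
  then have "diagram_of n (b_word n ws) = word_diagram n ws"
    unfolding diagram_of_def using word_diagram_planar[OF assms] by (intro the_equality) auto
  then show ?thesis by (simp add: Q_word_def)
qed


section \<open>Multiplication by a generator and colourings of the top row\<close>

definition proper_colorings :: "nat \<Rightarrow> diagram \<Rightarrow> (nat \<Rightarrow> 'k::field) set" where
  "proper_colorings n d =
     {v \<in> two_valued n. \<forall>a b. {Top a, Top b} \<in> d \<longrightarrow> v a \<noteq> v b}"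

lemma act_two_valued:
  assumes "a \<in> {1..n+1}" "b \<in> {1..n+1}" "v \<in> two_valued n"
  shows "act (transpose a b) v \<in> two_valued n"
proof -
  let ?t = "transpose a b"
  have t: "?t permutes {1..n+1}" using assms(1,2) by (rule permutes_swap_id)
  have v: "\<forall>i. i \<notin> {1..n+1} \<longrightarrow> v i = 0" "(\<Sum>i\<in>{1..n+1}. v i) = 0" "card (v ` {1..n+1}) \<le> 2"
    using assms(3) unfolding two_valued_def geom_rep_def by blast+
  have "(\<Sum>i\<in>{1..n+1}. v (?t i)) = 0"
    using sum.permute[OF t, of v] v(2) by (simp only: o_def)
  moreover have "(\<lambda>x. v (?t x)) ` {1..n+1} = v ` {1..n+1}"
    using permutes_image[OF t] by (metis image_image)
  moreover have "v (?t i) = 0" if "i \<notin> {1..n+1}" for i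
    using v(1) that assms(1,2) by (metis transpose_apply_other)
  ultimately show ?thesis
    using v(3) by (simp only: act_transpose_apply two_valued_def geom_rep_def mem_Collect_eq) blast
qed

lemma proper_colorings_loop:
  assumes d: "matching n d" and loop: "{Top i, Top (i + 1)} \<in> d"
    and v: "v \<in> two_valued n" "v i \<noteq> v (i + 1)"
    and s: "act (transpose i (i + 1)) v \<in> proper_colorings n d"
  shows "v \<in> proper_colorings n d"
  unfolding proper_colorings_def
proof (intro CollectI conjI allI impI)
  fix a b assume ab: "{Top a, Top b} \<in> d"
  show "v a \<noteq> v b"
  proof (cases "{Top a, Top b} = {Top i, Top (i + 1)}")
    case True
    then have "a = i \<and> b = i + 1 \<or> a = i + 1 \<and> b = i" by (simp add: doubleton_eq_iff)
    then show ?thesis using v(2) by auto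
  next
    case False
    then have "a \<notin> {i, i + 1}" "b \<notin> {i, i + 1}"
      using matching_unique[OF d ab loop] by blast+
    moreover have "act (transpose i (i + 1)) v a \<noteq> act (transpose i (i + 1)) v b"
      using s ab by (simp add: proper_colorings_def)
    ultimately show ?thesis by (simp add: act_transpose_apply)
  qed
qed (rule v(1))

context
  fixes n i d p q
  assumes d: "matching n d" and i: "i \<in> {1..n}"
    and arcs: "{Top i, p} \<in> d" "{Top (i + 1), q} \<in> d"
    and no_loop: "{Top i, Top (i + 1)} \<notin> d"
begin

lemma top_partner:
  "p = Top a \<Longrightarrow> a \<in> {1..n+1} \<and> a \<noteq> i \<and> a \<noteq> i + 1"
  "q = Top b \<Longrightarrow> b \<in> {1..n+1} \<and> b \<noteq> i \<and> b \<noteq> i + 1"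
  using rewire_distinct[OF d arcs no_loop] matching_endpoints[OF d arcs(1)]
    matching_endpoints[OF d arcs(2)] by auto

lemma kept_top_arc:
  assumes "{Top a, Top b} \<in> d - {{Top i, p}, {Top (i + 1), q}}"
  shows "a \<notin> {i, i + 1}" "b \<notin> {i, i + 1}"
  using kept_arc[OF d arcs no_loop assms] by blast+

text \<open>
  The arcs of \<open>d\<close> at \<open>i\<close> and \<open>i + 1\<close> force the colours of \<open>p\<close> and \<open>q\<close>, if these are top points, to be
  those of \<open>i + 1\<close> and \<open>i\<close> under \<open>v'\<close>, hence to be different. Below, \<open>v'\<close> is \<open>v\<close> or \<open>s\<^sub>i v\<close>.
\<close>

lemma proper_colorings_rewire_if:
  assumes v: "v \<in> two_valued n" "v i \<noteq> v (i + 1)"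
    and v': "v' \<in> proper_colorings n d" "v' i \<noteq> v' (i + 1)"
      "\<And>x. x \<notin> {i, i + 1} \<Longrightarrow> v' x = v x"
  shows "v \<in> proper_colorings n (rewire i p q d)"
  unfolding proper_colorings_def
proof (intro CollectI conjI allI impI)
  have tv: "v' \<in> two_valued n" and proper: "\<And>a b. {Top a, Top b} \<in> d \<Longrightarrow> v' a \<noteq> v' b"
    using v'(1) by (auto simp: proper_colorings_def)
  have joined: "v a \<noteq> v b" if "p = Top a" "q = Top b" for a b
  proof -
    note ab = top_partner(1)[OF that(1)] top_partner(2)[OF that(2)]
    have "v' i \<noteq> v' a" "v' (i + 1) \<noteq> v' b" using proper arcs that by auto
    moreover have "v' a = v' i \<or> v' a = v' (i + 1)" "v' b = v' i \<or> v' b = v' (i + 1)"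
      using two_valued_pigeonhole[OF tv _ _ _ v'(2)] ab i by auto
    ultimately have "v' a \<noteq> v' b" using v'(2) by auto
    then show ?thesis using v'(3) ab by auto
  qed
  fix a b assume ab: "{Top a, Top b} \<in> rewire i p q d"
  then consider "{Top a, Top b} = {Top i, Top (i + 1)}" | "{Top a, Top b} = {p, q}"
    | "{Top a, Top b} \<in> d - {{Top i, p}, {Top (i + 1), q}}"
    unfolding rewire_def by blast
  then show "v a \<noteq> v b"
  proof cases
    case 1
    then have "a = i \<and> b = i + 1 \<or> a = i + 1 \<and> b = i" by (simp add: doubleton_eq_iff)
    then show ?thesis using v(2) by auto
  next
    case 2
    then have "p = Top a \<and> q = Top b \<or> p = Top b \<and> q = Top a"
      unfolding doubleton_eq_iff by blast
    then show ?thesis using joined by metis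
  next
    case 3
    then show ?thesis using kept_top_arc[OF 3] v'(3) proper[of a b] by auto
  qed
qed (rule v(1))

lemma proper_colorings_unrewire:
  assumes v: "v \<in> proper_colorings n (rewire i p q d)"
    and v': "v' \<in> two_valued n" "\<And>x. x \<notin> {i, i + 1} \<Longrightarrow> v' x = v x"
    and p: "\<And>a. p = Top a \<Longrightarrow> v' i \<noteq> v a" and q: "\<And>b. q = Top b \<Longrightarrow> v' (i + 1) \<noteq> v b"
  shows "v' \<in> proper_colorings n d"
  unfolding proper_colorings_def
proof (intro CollectI conjI allI impI)
  fix a b assume ab: "{Top a, Top b} \<in> d"
  then consider "{Top a, Top b} = {Top i, p}" | "{Top a, Top b} = {Top (i + 1), q}"
    | "{Top a, Top b} \<in> d - {{Top i, p}, {Top (i + 1), q}}" by blast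
  then show "v' a \<noteq> v' b"
  proof cases
    case 1
    then have "a = i \<and> p = Top b \<or> b = i \<and> p = Top a" by (auto simp: doubleton_eq_iff)
    then show ?thesis using p v'(2) top_partner(1) by (metis insertE singletonD)
  next
    case 2
    then have "a = i + 1 \<and> q = Top b \<or> b = i + 1 \<and> q = Top a" by (auto simp: doubleton_eq_iff)
    then show ?thesis using q v'(2) top_partner(2) by (metis insertE singletonD)
  next
    case 3
    then have "{Top a, Top b} \<in> rewire i p q d" unfolding rewire_def by blast
    then have "v a \<noteq> v b" using v unfolding proper_colorings_def by blast
    then show ?thesis using kept_top_arc[OF 3] v'(2) by simp
  qed
qed (rule v'(1))

text \<open>
  If \<open>p\<close> is a top point, its colour is that of exactly one of \<open>i\<close> and \<open>i + 1\<close>, and this decides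
  whether \<open>v\<close> or \<open>s\<^sub>i v\<close> is proper along \<open>{i, p}\<close>; the same vector is proper along \<open>{i + 1, q}\<close>,
  because \<open>p\<close> and \<open>q\<close> have different colours. If only \<open>q\<close> is a top point, it decides, and if neither
  is, both vectors will do.
\<close>

lemma proper_colorings_rewire_only_if:
  assumes v: "v \<in> proper_colorings n (rewire i p q d)"
  shows "v \<in> proper_colorings n d \<or> act (transpose i (i + 1)) v \<in> proper_colorings n d"
proof -
  have tv: "v \<in> two_valued n"
    and proper: "\<And>a b. {Top a, Top b} \<in> rewire i p q d \<Longrightarrow> v a \<noteq> v b"
    using v by (auto simp: proper_colorings_def)
  have ne: "v i \<noteq> v (i + 1)" by (rule proper) (simp add: rewire_def)
  have joined: "v a \<noteq> v b" if "p = Top a" "q = Top b" for a b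
    by (rule proper) (simp add: rewire_def that)
  have color: "v x = v i \<or> v x = v (i + 1)" if "x \<in> {1..n+1}" for x
    using two_valued_pigeonhole[OF tv _ _ that ne] i by auto
  have "(\<forall>a. p = Top a \<longrightarrow> v i \<noteq> v a) \<and> (\<forall>b. q = Top b \<longrightarrow> v (i + 1) \<noteq> v b) \<or>
    (\<forall>a. p = Top a \<longrightarrow> v (i + 1) \<noteq> v a) \<and> (\<forall>b. q = Top b \<longrightarrow> v i \<noteq> v b)"
  proof (cases "\<exists>a. p = Top a")
    case True
    then obtain a where a: "p = Top a" by blast
    have va: "v a = v i \<or> v a = v (i + 1)" using color top_partner(1)[OF a] by blast
    have vb: "v b \<noteq> v a \<and> (v b = v i \<or> v b = v (i + 1))" if "q = Top b" for b
      using color top_partner(2)[OF that] joined[OF a that] by auto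
    show ?thesis
    proof (cases "v a = v i")
      case True
      then have "v b = v (i + 1)" if "q = Top b" for b using vb[OF that] by auto
      then show ?thesis using True ne a by auto
    next
      case False
      then have "v b = v i" if "q = Top b" for b using vb[OF that] va by auto
      then show ?thesis using False ne a by auto
    qed
  next
    case False
    then show ?thesis using ne by (metis point.inject(1))
  qed
  then show ?thesis
  proof
    assume "(\<forall>a. p = Top a \<longrightarrow> v i \<noteq> v a) \<and> (\<forall>b. q = Top b \<longrightarrow> v (i + 1) \<noteq> v b)"
    then show ?thesis using proper_colorings_unrewire[OF v tv] by blast
  next
    assume *: "(\<forall>a. p = Top a \<longrightarrow> v (i + 1) \<noteq> v a) \<and> (\<forall>b. q = Top b \<longrightarrow> v i \<noteq> v b)"
    have "act (transpose i (i + 1)) v \<in> proper_colorings n d"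
    proof (rule proper_colorings_unrewire[OF v])
      show "act (transpose i (i + 1)) v \<in> two_valued n"
        using act_two_valued[OF _ _ tv, of i "i + 1"] i by simp
    qed (use * in \<open>auto simp: act_transpose_apply\<close>)
    then show ?thesis by blast
  qed
qed

end

text \<open>
  This equivalence mirrors the recursive clause of \<open>W_word\<close>.
\<close>

lemma proper_colorings_gen_comp:
  assumes d: "planar_diagram n d" and i: "i \<in> {1..n}"
  shows "v \<in> proper_colorings n (diagram_comp (gen_diagram n i) d) \<longleftrightarrow>
    v \<in> two_valued n \<and> v i \<noteq> v (i + 1) \<and>
    (v \<in> proper_colorings n d \<or> act (simple_refl i) v \<in> proper_colorings n d)"
  using d i
proof (cases rule: gen_comp_cases)
  case loop
  then show ?thesis
    using proper_colorings_loop[OF planar_matching[OF d] loop(1), of v]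
    unfolding simple_refl_def by (auto simp: proper_colorings_def)
next
  case (rewire p q)
  note ctx = planar_matching[OF d] i rewire(1-3)
  show ?thesis
  proof
    assume "v \<in> proper_colorings n (diagram_comp (gen_diagram n i) d)"
    then have v: "v \<in> proper_colorings n (rewire i p q d)" by (simp add: rewire(4))
    then have "v \<in> two_valued n" "v i \<noteq> v (i + 1)"
      by (auto simp: proper_colorings_def rewire_def)
    then show "v \<in> two_valued n \<and> v i \<noteq> v (i + 1) \<and>
        (v \<in> proper_colorings n d \<or> act (simple_refl i) v \<in> proper_colorings n d)"
      using proper_colorings_rewire_only_if[OF ctx v] by (simp add: simple_refl_def)
  next
    assume "v \<in> two_valued n \<and> v i \<noteq> v (i + 1) \<and>
        (v \<in> proper_colorings n d \<or> act (simple_refl i) v \<in> proper_colorings n d)"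
    then have v: "v \<in> two_valued n" "v i \<noteq> v (i + 1)"
      and "v \<in> proper_colorings n d \<or> act (transpose i (i + 1)) v \<in> proper_colorings n d"
      by (auto simp: simple_refl_def)
    then obtain v' where "v' \<in> proper_colorings n d" "v' = v \<or> v' = act (transpose i (i + 1)) v"
      by blast
    then have "v \<in> proper_colorings n (rewire i p q d)"
      using v by (intro proper_colorings_rewire_if[OF ctx v, of v']) (auto simp: act_transpose_apply)
    then show "v \<in> proper_colorings n (diagram_comp (gen_diagram n i) d)" by (simp add: rewire(4))
  qed
qed


section \<open>The set of a word as the proper colourings of its diagram\<close>

lemma proper_colorings_identity:
  "(proper_colorings n (word_diagram n []) :: (nat \<Rightarrow> 'k::field) set) = two_valued n"
proof -
  have "{Top a, Top b} \<notin> word_diagram n []" for a b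
  proof
    assume "{Top a, Top b} \<in> word_diagram n []"
    then obtain j where "{Top a, Top b} = {Top j, Bot j}" unfolding word_diagram.simps by blast
    then have "Bot j \<in> {Top a, Top b}" by simp
    then show False by simp
  qed
  then show ?thesis unfolding proper_colorings_def by blast
qed

lemma act_image_iff: "v \<in> act (simple_refl i) ` X \<longleftrightarrow> act (simple_refl i) v \<in> X"
proof
  assume "v \<in> act (simple_refl i) ` X"
  then show "act (simple_refl i) v \<in> X" by (auto simp: simple_refl_def act_transpose_involutory)
next
  assume "act (simple_refl i) v \<in> X"
  then show "v \<in> act (simple_refl i) ` X"
    by (intro image_eqI[of v _ "act (simple_refl i) v"])
      (simp_all add: simple_refl_def act_transpose_involutory)
qed

lemma act_eq_0_iff: "act (simple_refl i) v = 0 \<longleftrightarrow> v = (0 :: nat \<Rightarrow> 'k::field)"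
proof -
  have "act (transpose i (i + 1)) (0 :: nat \<Rightarrow> 'k) = 0" by (simp add: act_transpose_apply fun_eq_iff)
  then show ?thesis unfolding simple_refl_def by (metis act_transpose_involutory)
qed

text \<open>
  The recursion of \<open>W_word\<close> starts at one-letter words. These also fit the pattern of the induction
  step, since all two-valued vectors are proper colourings of the identity diagram.
\<close>

lemma W_word_eq:
  assumes "ws \<noteq> []" "set ws \<subseteq> {1..n}"
  shows "(W_word n ws :: (nat \<Rightarrow> 'k::field_char_0) set) =
    insert 0 (proper_colorings n (word_diagram n ws))"
  using assms
proof (induction ws rule: list_nonempty_induct)
  case (single i)
  have i: "i \<in> {1..n}" using single by simp
  have V: "(V_refl n (simple_refl i) :: (nat \<Rightarrow> 'k) set) =
      insert 0 {v. v \<in> two_valued n \<and> v i \<noteq> v (i + 1)}"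
    unfolding simple_refl_def by (rule V_refl_transpose) (use i in auto)
  show ?case
    using proper_colorings_gen_comp[OF identity_planar i, where 'a='k]
    unfolding W_word.simps V word_diagram.simps(2) proper_colorings_identity by blast
next
  case (cons i ws)
  have i: "i \<in> {1..n}" and ws: "set ws \<subseteq> {1..n}" using cons.prems by auto
  have V: "(V_refl n (simple_refl i) :: (nat \<Rightarrow> 'k) set) =
      insert 0 {v. v \<in> two_valued n \<and> v i \<noteq> v (i + 1)}"
    unfolding simple_refl_def by (rule V_refl_transpose) (use i in auto)
  obtain j js where "ws = j # js" using cons.hyps by (cases ws) auto
  then have W: "(W_word n (i # ws) :: (nat \<Rightarrow> 'k) set) =
      V_refl n (simple_refl i) \<inter> (W_word n ws \<union> act (simple_refl i) ` W_word n ws)" by simp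
  have "v \<in> W_word n (i # ws) \<longleftrightarrow> v \<in> insert 0 (proper_colorings n (word_diagram n (i # ws)))"
    for v :: "nat \<Rightarrow> 'k"
    unfolding W V Int_iff Un_iff act_image_iff cons.IH[OF ws] word_diagram.simps(2) insert_iff
      act_eq_0_iff mem_Collect_eq proper_colorings_gen_comp[OF word_diagram_planar[OF ws] i]
    by blast
  then show ?case by blast
qed


section \<open>The reflections of a word\<close>

lemma cap_in_gen_comp:
  assumes "planar_diagram n d" "i \<in> {1..n}"
  shows "{Top i, Top (i + 1)} \<in> diagram_comp (gen_diagram n i) d"
  using assms by (cases rule: gen_comp_cases) (auto simp: rewire_def)

lemma top_arcs_commute:
  assumes d: "matching n d" and arcs: "{Top a, Top b} \<in> d" "{Top a', Top b'} \<in> d"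
  shows "transpose a b \<circ> transpose a' b' = transpose a' b' \<circ> transpose a b"
proof (cases "{Top a, Top b} = {Top a', Top b'}")
  case True
  then have "transpose a b = transpose a' b'"
    by (auto simp: doubleton_eq_iff transpose_commute)
  then show ?thesis by simp
next
  case False
  then have "{Top a, Top b} \<inter> {Top a', Top b'} = {}" using matching_unique[OF d arcs] by blast
  then have "a \<noteq> a'" "a \<noteq> b'" "b \<noteq> a'" "b \<noteq> b'" by auto
  then show ?thesis by (auto simp: fun_eq_iff transpose_def)
qed

theorem proposition3p7:
  fixes n :: nat and w :: "nat \<Rightarrow> nat" and ws :: "nat list"
  assumes "n \<ge> 1"
    and "fully_commutative n w"
    and "reduced_expression n ws w"
    and "ws \<noteq> []"
  shows "T_word TYPE('k::field_char_0) n ws = Q_word n ws"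
proof -
  have ws: "set ws \<subseteq> {1..n}"
    using assms(3) by (simp add: reduced_expression_def expression_def)
  define d where "d = word_diagram n ws"
  have planar: "planar_diagram n d" unfolding d_def by (rule word_diagram_planar[OF ws])
  note d = planar_matching[OF planar]
  define Q where "Q = Q_word n ws"
  have Q: "Q = {transpose a b | a b. {Top a, Top b} \<in> d}"
    unfolding Q_def d_def by (rule Q_word_eq[OF ws])
  have top_arc: "a \<in> {1..n+1}" "b \<in> {1..n+1}" "a \<noteq> b" if "{Top a, Top b} \<in> d" for a b
    using matching_endpoints[OF d that] by auto
  have Q_refl: "Q \<subseteq> reflections n"
    unfolding Q reflections_def using top_arc by blast
  have Q_comm: "\<forall>s\<in>Q. \<forall>t\<in>Q. s \<circ> t = t \<circ> s"
    unfolding Q using top_arcs_commute[OF d] by blast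
  obtain i js where "ws = i # js" using assms(4) by (cases ws) auto
  then have "{Top i, Top (i + 1)} \<in> d"
    using cap_in_gen_comp[of n "word_diagram n js" i] word_diagram_planar[of js n] ws
    by (simp add: d_def)
  then have Q_ne: "Q \<noteq> {}" unfolding Q by blast
  have V: "V_refl n (transpose a b) = insert 0 {v :: nat \<Rightarrow> 'k. v \<in> two_valued n \<and> v a \<noteq> v b}"
    if "{Top a, Top b} \<in> d" for a b
    by (rule V_refl_transpose[OF top_arc[OF that]])
  have inter: "(W_word n ws :: (nat \<Rightarrow> 'k) set) = (\<Inter>t\<in>Q. V_refl n t)"
  proof (rule set_eqI)
    fix v :: "nat \<Rightarrow> 'k"
    have "v \<in> (\<Inter>t\<in>Q. V_refl n t) \<longleftrightarrow>
        (\<forall>a b. {Top a, Top b} \<in> d \<longrightarrow> v \<in> V_refl n (transpose a b))"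
      unfolding Q by blast
    also have "\<dots> \<longleftrightarrow> (\<forall>a b. {Top a, Top b} \<in> d \<longrightarrow> v = 0 \<or> v \<in> two_valued n \<and> v a \<noteq> v b)"
      using V by auto
    \<comment> \<open>Since there is at least one arc, the left-hand side forces a nonzero \<open>v\<close> to be two-valued.\<close>
    also have "\<dots> \<longleftrightarrow> v \<in> insert 0 (proper_colorings n d)"
      using \<open>{Top i, Top (i + 1)} \<in> d\<close> unfolding proper_colorings_def by blast
    finally show "v \<in> W_word n ws \<longleftrightarrow> v \<in> (\<Inter>t\<in>Q. V_refl n t)"
      unfolding W_word_eq[OF assms(4) ws] d_def by blast
  qed
  have "T_word TYPE('k) n ws = Q"
    unfolding T_word_def
  proof (rule the_equality)
    show "Q \<noteq> {} \<and> Q \<subseteq> reflections n \<and> (\<forall>s\<in>Q. \<forall>t\<in>Q. s \<circ> t = t \<circ> s) \<and>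
        (W_word n ws :: (nat \<Rightarrow> 'k) set) = (\<Inter>t\<in>Q. V_refl n t)"
      using Q_ne Q_refl Q_comm inter by blast
  next
    fix S assume "S \<noteq> {} \<and> S \<subseteq> reflections n \<and> (\<forall>s\<in>S. \<forall>t\<in>S. s \<circ> t = t \<circ> s) \<and>
        (W_word n ws :: (nat \<Rightarrow> 'k) set) = (\<Inter>t\<in>S. V_refl n t)"
    then show "S = Q"
      using commuting_set_unique[of S n Q, where 'k='k] Q_ne Q_refl Q_comm inter by metis
  qed
  then show ?thesis by (simp add: Q_def)
qed

end
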